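(* Let $(\omega_{g,n})_{g\ge0,n\ge1}$ be a system of correlators on a locally admissible spectral curve $\mathcal S=(\Sigma,x,\omega_{0,1},\omega_{0,2})$ that satisfies topological recursion. Suppose that $q\in x(\Sigma)$ is not a branch point and let $x^{-1}(q)=\{p_1,\dots,p_d\}$ (finite), with $\bar s_i=\bar s_{p_i}$, $\tau_i=\tau_{p_i}$. Then topological recursion can be globalised above $q$ (i.e. over $x^{-1}(q)$) if the following two conditions are satisfied: - at most one of the $p_i$ has $\bar s_i\ge2$ (i.e. $\omega_{0,1}$ does not vanish at two distinct points in the fibre); - for any $i\ne j$ such that $\bar s_i=\bar s_j$, we have $\tau_i\ne\tau_j$.
   Context: **Spectral curves.** A spectral curve is $\mathcal S=(\Sigma,x,\omega_{0,1},\omega_{0,2})$ with $\Sigma$ a finite disjoint union of (connected) Riemann surfaces, $x:\Sigma\to\mathbb P^1$ holomorphic, non-constant on each component, $\omega_{0,1}$ a meromorphic 1-form not identically zero on any component, $\omega_{0,2}$ a symmetric meromorphic bidifferential on $\Sigma\times\Sigma$ whose only poles are a double pole on the diagonal with biresidue $1$. $y=\omega_{0,1}/dx$. At $p$, $r_p$ is the ramification order of $x$; a standard coordinate is a local coordinate $\zeta$ centred at $p$ with $x=x(p)+\zeta^{r_p}$, or $x=\zeta^{-r_p}$ if $x(p)=\infty$; $\omega_{0,1}=\sum_{l\ge\bar s_p}\tau_{p,l}\zeta^l\frac{d\zeta}\zeta$ with $\tau_p:=\tau_{p,\bar s_p}\ne0$; $s_p=\min\{l:\tau_{p,l}\ne0,r_p\nmid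 l\}$ ($\infty$ if empty). $\mathsf{Ram}=\{r_p\ge2\}$; branch points are elements of $x(\mathsf{Ram})$. $\mathcal S$ is locally admissible if $\mathsf{Ram}$ is finite and at each $p\in\mathsf{Ram}$: $s_p,r_p$ are coprime; $s_p\le-1$, or $s_p\in\{1,\dots,r_p+1\}$ and $r_p\equiv\pm1\pmod{s_p}$; $\bar s_p\in\{s_p,s_p-1\}$. **Topological recursion.** $\mathfrak f(z)=x^{-1}(x(z))$. For $q\in x(\Sigma)$ choose small simply-connected $V\ni q$ and disjoint $U_p\ni p$ ($p\in x^{-1}(q)$) with $x^{-1}(V)=\bigsqcup_pU_p$; $\mathfrak f'_p(z)=(\mathfrak f(z)\cap U_p)\setminus\{z\}$, $\mathfrak f'_P(z)=\big(\mathfrak f(z)\cap\bigsqcup_{p\in P}U_p\big)\setminus\{z\}$ for $P\subseteq x^{-1}(q)$. A system of correlators is a family $(\omega_{g,n})_{g\ge0,n\ge1}$ of symmetric meromorphic $n$-differentials on $\Sigma^n$, with $\omega_{0,1},\omega_{0,2}$ those of $\mathcal S$, such that for $2g-2+n>0$, $\omega_{g,n}$ has poles only at ramification points, with vanishing residues. $\mathcal W'_{g,i;n}(z_{[i]};w_{[n]})=\sum\prod_{L\in\mathbf L}\omega_{g_L,|L|+|M_L|}(z_L,w_{M_L})$, summed over set partitions $\mathbf L$ of $\{1,\dots,i\}$, tuples $(M_L)$ of disjoint possibly empty sets with union $\{1,\dots,n\}$, and $g_L\ge0$ with $i+\sum_L(g_L-1)=g$, omitting terms containing a factor $\omega_{0,1}$.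 Local primitives: $\alpha^{(p)}_{0,2}(w_0;z)$, meromorphic 1-form in $w_0\in\Sigma$ and meromorphic function in $z\in U_p$, with $d_z\alpha^{(p)}_{0,2}(w_0;z)=\omega_{0,2}(w_0,z)$; $K^{(p)}_{1+|Z|}(w_0;z,Z)=-\alpha^{(p)}_{0,2}(w_0;z)\big/\prod_{z'\in Z}((y(z')-y(z))dx(z))$. Topological recursion: for $g,n\ge0$, $2g-2+(1+n)>0$, $\omega_{g,1+n}(w_0,w_{[n]})=\sum_{p\in\Sigma}\operatorname{Res}_{z=p}\sum_{Z\subseteq\mathfrak f'_p(z),|Z|\ge1}K^{(p)}_{1+|Z|}(w_0;z,Z)\mathcal W'_{g,1+|Z|;n}(z,Z;w_{[n]})$ (for some, equivalently any, local primitives). **Globalisation.** Topological recursion can be globalised over a finite $P\subseteq x^{-1}(q)$ if for all such $g,n$ (and every choice of local primitives) $$\sum_{p\in P}\operatorname*{Res}_{z=p}\sum_{\substack{Z\subseteq\mathfrak f'_p(z)\\|Z|\ge1}}K^{(p)}_{1+|Z|}(w_0;z,Z)\mathcal W'_{g,1+|Z|;n}(z,Z;w_{[n]})=\sum_{p\in P}\operatorname*{Res}_{z=p}\sum_{\substack{Z\subseteq\mathfrak f'_P(z)\\|Z|\ge1}}K^{(p)}_{1+|Z|}(w_0;z,Z)\mathcal W'_{g,1+|Z|;n}(z,Z;w_{[n]}).$$ *)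

theory Defs
  imports
    "HOL-Complex_Analysis.Complex_Analysis"
    "HOL-Library.Disjoint_Sets"
    "HOL-Library.Groups_Big_Fun"
    "HOL-Number_Theory.Cong"
begin

section \<open>Functions of several complex variables\<close>

text \<open>A point of \<open>\<complex>\<^sup>n\<close> is a list of length \<open>n\<close>.\<close>

definition polydisc :: "complex list \<Rightarrow> real \<Rightarrow> complex list set" where
  "polydisc c r = {t. length t = length c \<and> (\<forall>i<length c. dist (t ! i) (c ! i) < r)}"

definition cdifferentiable_at :: "(complex list \<Rightarrow> complex) \<Rightarrow> complex list \<Rightarrow> bool" where
  "cdifferentiable_at F c \<longleftrightarrow>
     (\<exists>D :: nat \<Rightarrow> complex. \<forall>\<epsilon>>0. \<exists>\<delta>>0. \<forall>t\<in>polydisc c \<delta>.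
        norm (F t - F c - (\<Sum>i<length c. D i * (t ! i - c ! i)))
          \<le> \<epsilon> * (\<Sum>i<length c. norm (t ! i - c ! i)))"

definition holo_near :: "(complex list \<Rightarrow> complex) \<Rightarrow> complex list \<Rightarrow> bool" where
  "holo_near F c \<longleftrightarrow> (\<exists>r>0. \<forall>t\<in>polydisc c r. cdifferentiable_at F t)"

text \<open>
  Near \<open>c\<close>, \<open>F\<close> is a quotient \<open>G / H\<close> of holomorphic functions. Meromorphic functions are
  represented by total functions whose values on the polar locus are arbitrary. The last clause
  says that \<open>F\<close> has its true value wherever the quotient extends holomorphically; hence \<open>c\<close>
  lies on the polar locus exactly if \<open>holo_near F c\<close> fails.
\<close>

definition mero_near :: "(complex list \<Rightarrow> complex) \<Rightarrow> complex list \<Rightarrow> bool" where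
  "mero_near F c \<longleftrightarrow>
     (\<exists>r>0. \<exists>G H.
        (\<forall>t\<in>polydisc c r. cdifferentiable_at G t \<and> cdifferentiable_at H t) \<and>
        (\<exists>t\<in>polydisc c r. H t \<noteq> 0) \<and>
        (\<forall>t\<in>polydisc c r. H t \<noteq> 0 \<longrightarrow> F t = G t / H t) \<and>
        (\<forall>t\<in>polydisc c r. \<forall>E.
           holo_near E t \<and> (\<exists>\<rho>>0. \<forall>u\<in>polydisc t \<rho>. H u \<noteq> 0 \<longrightarrow> E u = F u) \<longrightarrow> F t = E t))"


section \<open>Riemann surfaces\<close>

text \<open>A coordinate is a pair of a domain and a function on it. Surfaces are Hausdorff types.\<close>

type_synonym 'a coord = "'a set \<times> ('a \<Rightarrow> complex)"

abbreviation coord_inv :: "'a coord \<Rightarrow> complex \<Rightarrow> 'a" where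
  "coord_inv c \<equiv> inv_into (fst c) (snd c)"

definition complex_atlas :: "'a::topological_space coord set \<Rightarrow> bool" where
  "complex_atlas A \<longleftrightarrow>
     (\<Union>c\<in>A. fst c) = UNIV \<and>
     (\<forall>c\<in>A. open (fst c) \<and> open (snd c ` fst c) \<and>
        homeomorphism (fst c) (snd c ` fst c) (snd c) (coord_inv c)) \<and>
     (\<forall>c\<in>A. \<forall>d\<in>A. (snd d \<circ> coord_inv c) holomorphic_on snd c ` (fst c \<inter> fst d))"

definition local_coords :: "'a::topological_space coord set \<Rightarrow> 'a coord set" where
  "local_coords A = {c. open (fst c) \<and> inj_on (snd c) (fst c) \<and>
     (\<forall>d\<in>A. (snd c \<circ> coord_inv d) holomorphic_on snd d ` (fst c \<inter> fst d))}"

text \<open>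
  The connected components of a manifold are open, so the surface is the disjoint union of
  its finitely many components.
\<close>

definition finite_union_of_riemann_surfaces :: "'a::t2_space coord set \<Rightarrow> bool" where
  "finite_union_of_riemann_surfaces A \<longleftrightarrow>
     complex_atlas A \<and> finite (components (UNIV :: 'a set))"

definition holomorphic_map ::
    "'a::topological_space coord set \<Rightarrow> 'b::topological_space coord set \<Rightarrow> ('a \<Rightarrow> 'b) \<Rightarrow> bool" where
  "holomorphic_map A B f \<longleftrightarrow> continuous_on UNIV f \<and>
     (\<forall>c\<in>A. \<forall>d\<in>B. (snd d \<circ> f \<circ> coord_inv c) holomorphic_on snd c ` (fst c \<inter> f -` fst d))"

definition coord_at :: "'a::topological_space coord set \<Rightarrow> 'a \<Rightarrow> 'a coord" where
  "coord_at A p = (SOME c. c \<in> local_coords A \<and> p \<in> fst c)"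


section \<open>The Riemann sphere\<close>

datatype sphere = Fin complex | Infty

primrec fin_part :: "sphere \<Rightarrow> complex" where
  "fin_part (Fin z) = z"
| "fin_part Infty = 0"

primrec sphere_inv :: "sphere \<Rightarrow> sphere" where
  "sphere_inv (Fin z) = (if z = 0 then Infty else Fin (inverse z))"
| "sphere_inv Infty = Fin 0"

text \<open>The topology obtained by glueing the two affine lines \<open>z\<close> and \<open>1 / z\<close>.\<close>

instantiation sphere :: topological_space
begin

definition open_sphere :: "sphere set \<Rightarrow> bool" where
  "open_sphere S \<longleftrightarrow> open (Fin -` S) \<and> open ((\<lambda>z. sphere_inv (Fin z)) -` S)"

instance
proof
  show "open (UNIV :: sphere set)"
    by (simp add: open_sphere_def)
next
  fix S T :: "sphere set"
  assume "open S" "open T"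
  then show "open (S \<inter> T)"
    by (simp add: open_sphere_def vimage_Int open_Int)
next
  fix K :: "sphere set set"
  assume "\<forall>S\<in>K. open S"
  then show "open (\<Union>K)"
    by (simp add: open_sphere_def vimage_Union open_UN)
qed

end

definition sphere_atlas :: "sphere coord set" where
  "sphere_atlas = {(UNIV - {Infty}, fin_part), (UNIV - {Fin 0}, fin_part \<circ> sphere_inv)}"

text \<open>The coordinate \<open>w - c\<close> at \<open>c\<close>, respectively \<open>1 / w\<close> at infinity.\<close>

primrec centred_coord :: "sphere \<Rightarrow> sphere \<Rightarrow> complex" where
  "centred_coord (Fin c) w = fin_part w - c"
| "centred_coord Infty w = fin_part (sphere_inv w)"


section \<open>Meromorphic differentials on powers of a surface\<close>

text \<open>
  A framed point is a point with a local coordinate around it. An \<open>n\<close>-differential \<open>\<omega>\<close> on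
  \<open>\<Sigma>\<^sup>n\<close> assigns to framed points \<open>[(c\<^sub>1, z\<^sub>1), \<dots>, (c\<^sub>n, z\<^sub>n)]\<close> the
  coefficient of \<open>dc\<^sub>1(z\<^sub>1) \<dots> dc\<^sub>n(z\<^sub>n)\<close> in \<open>\<omega>(z\<^sub>1, \<dots>, z\<^sub>n)\<close>.
\<close>

type_synonym 'a fpoint = "'a coord \<times> 'a"
type_synonym 'a ndiff = "'a fpoint list \<Rightarrow> complex"

definition fpoints :: "'a::topological_space coord set \<Rightarrow> 'a fpoint set" where
  "fpoints A = {(c, z). c \<in> local_coords A \<and> z \<in> fst c}"

definition coord_values :: "'a fpoint list \<Rightarrow> complex list" where
  "coord_values fs = map (\<lambda>(c, z). snd c z) fs"

definition local_expr :: "'a ndiff \<Rightarrow> 'a coord list \<Rightarrow> complex list \<Rightarrow> complex" where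
  "local_expr \<omega> cs ts = \<omega> (map2 (\<lambda>c t. (c, coord_inv c t)) cs ts)"

text \<open>The derivative \<open>dd/dc\<close> at \<open>z\<close>.\<close>

definition coord_deriv :: "'a coord \<Rightarrow> 'a coord \<Rightarrow> 'a \<Rightarrow> complex" where
  "coord_deriv c d z = deriv (snd d \<circ> coord_inv c) (snd c z)"

definition ndiff_regular_at :: "'a ndiff \<Rightarrow> 'a fpoint list \<Rightarrow> bool" where
  "ndiff_regular_at \<omega> fs \<longleftrightarrow> holo_near (local_expr \<omega> (map fst fs)) (coord_values fs)"

definition mero_ndiff :: "'a::topological_space coord set \<Rightarrow> nat \<Rightarrow> 'a ndiff \<Rightarrow> bool" where
  "mero_ndiff A n \<omega> \<longleftrightarrow>
     (\<forall>fs. set fs \<subseteq> fpoints A \<and> length fs = n \<longrightarrow>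
        mero_near (local_expr \<omega> (map fst fs)) (coord_values fs) \<and>
        (\<forall>ds. set (zip ds (map snd fs)) \<subseteq> fpoints A \<and> length ds = n \<longrightarrow>
           \<omega> fs = \<omega> (zip ds (map snd fs)) * (\<Prod>i<n. coord_deriv (fst (fs ! i)) (ds ! i) (snd (fs ! i)))))"

definition symmetric_ndiff :: "'a::topological_space coord set \<Rightarrow> nat \<Rightarrow> 'a ndiff \<Rightarrow> bool" where
  "symmetric_ndiff A n \<omega> \<longleftrightarrow>
     (\<forall>fs gs. set fs \<subseteq> fpoints A \<and> length fs = n \<and> mset fs = mset gs \<longrightarrow> \<omega> fs = \<omega> gs)"

text \<open>The residue at \<open>p\<close> of a 1-form, which does not depend on the coordinate at \<open>p\<close>.\<close>

definition form_residue :: "'a::topological_space coord set \<Rightarrow> 'a \<Rightarrow> ('a fpoint \<Rightarrow> complex) \<Rightarrow> complex" where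
  "form_residue A p \<eta> =
     (let c = coord_at A p in residue (\<lambda>t. \<eta> (c, coord_inv c t)) (snd c p))"


section \<open>Spectral curves\<close>

record 'a spectral_data =
  atlas :: "'a coord set"
  xmap :: "'a \<Rightarrow> sphere"
  om01 :: "'a ndiff"
  om02 :: "'a ndiff"

text \<open>The pole on the diagonal: of order two, with biresidue (leading coefficient) 1.\<close>

definition double_diagonal_pole :: "'a::topological_space coord set \<Rightarrow> 'a ndiff \<Rightarrow> bool" where
  "double_diagonal_pole A \<omega> \<longleftrightarrow>
     (\<forall>(c, p) \<in> fpoints A. \<exists>r>0. \<exists>G.
        (\<forall>ts\<in>polydisc [snd c p, snd c p] r. cdifferentiable_at G ts) \<and>
        (\<forall>t\<in>ball (snd c p) r. G [t, t] = 1) \<and>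
        (\<forall>t\<in>ball (snd c p) r. \<forall>u\<in>ball (snd c p) r. t \<noteq> u \<longrightarrow>
           local_expr \<omega> [c, c] [t, u] = G [t, u] / (t - u)\<^sup>2))"

definition spectral_curve :: "'a::t2_space spectral_data \<Rightarrow> bool" where
  "spectral_curve S \<longleftrightarrow>
     finite_union_of_riemann_surfaces (atlas S) \<and>
     holomorphic_map (atlas S) sphere_atlas (xmap S) \<and>
     (\<forall>C\<in>components UNIV. \<not> xmap S constant_on C) \<and>
     mero_ndiff (atlas S) 1 (om01 S) \<and>
     (\<forall>C\<in>components UNIV. \<exists>f\<in>fpoints (atlas S). snd f \<in> C \<and> om01 S [f] \<noteq> 0) \<and>
     mero_ndiff (atlas S) 2 (om02 S) \<and>
     symmetric_ndiff (atlas S) 2 (om02 S) \<and>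
     (\<forall>f\<in>fpoints (atlas S). \<forall>g\<in>fpoints (atlas S). snd f \<noteq> snd g \<longrightarrow> ndiff_regular_at (om02 S) [f, g]) \<and>
     double_diagonal_pole (atlas S) (om02 S)"

text \<open>
  The coefficient of \<open>dx\<close>, and \<open>y = \<omega>\<^sub>0\<^sub>,\<^sub>1 / dx\<close>. Values at poles of \<open>x\<close> are immaterial:
  only punctured neighbourhoods of such points are ever used.
\<close>

definition dx :: "'a spectral_data \<Rightarrow> 'a fpoint \<Rightarrow> complex" where
  "dx S = (\<lambda>(c, z). deriv (fin_part \<circ> xmap S \<circ> coord_inv c) (snd c z))"

definition yfun :: "'a::t2_space spectral_data \<Rightarrow> 'a \<Rightarrow> complex" where
  "yfun S z = (let f = (coord_at (atlas S) z, z) in om01 S [f] / dx S f)"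

definition ram_order :: "'a::t2_space spectral_data \<Rightarrow> 'a \<Rightarrow> nat" where
  "ram_order S p =
     (let c = coord_at (atlas S) p
      in nat (zorder (centred_coord (xmap S p) \<circ> xmap S \<circ> coord_inv c) (snd c p)))"

definition Ram :: "'a::t2_space spectral_data \<Rightarrow> 'a set" where
  "Ram S = {p. ram_order S p \<ge> 2}"

definition standard_coord :: "'a::t2_space spectral_data \<Rightarrow> 'a \<Rightarrow> 'a coord \<Rightarrow> bool" where
  "standard_coord S p c \<longleftrightarrow>
     c \<in> local_coords (atlas S) \<and> p \<in> fst c \<and> snd c p = 0 \<and>
     (\<forall>z\<in>fst c. xmap S z =
        (case xmap S p of
           Fin a \<Rightarrow> Fin (a + snd c z ^ ram_order S p)
         | Infty \<Rightarrow> sphere_inv (Fin (snd c z ^ ram_order S p))))"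

text \<open>
  \<open>\<tau>\<^bsub>p,l\<^esub>\<close>. Different standard coordinates differ by a root of unity of order \<open>r\<^sub>p\<close>, so the
  vanishing of \<open>\<tau>\<^bsub>p,l\<^esub>\<close> does not depend on the choice, nor does its value if \<open>r\<^sub>p = 1\<close>.
\<close>

definition tau_coeff :: "'a::t2_space spectral_data \<Rightarrow> 'a \<Rightarrow> int \<Rightarrow> complex" where
  "tau_coeff S p l =
     (let c = (SOME c. standard_coord S p c)
      in fls_nth (laurent_expansion (\<lambda>t. om01 S [(c, coord_inv c t)]) 0) (l - 1))"

definition sbar :: "'a::t2_space spectral_data \<Rightarrow> 'a \<Rightarrow> int" where
  "sbar S p = (LEAST l. tau_coeff S p l \<noteq> 0)"

definition tau :: "'a::t2_space spectral_data \<Rightarrow> 'a \<Rightarrow> complex" where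
  "tau S p = tau_coeff S p (sbar S p)"

text \<open>\<open>None\<close> stands for \<open>s\<^sub>p = \<infinity>\<close>.\<close>

definition sval :: "'a::t2_space spectral_data \<Rightarrow> 'a \<Rightarrow> int option" where
  "sval S p =
     (let Q = (\<lambda>l. tau_coeff S p l \<noteq> 0 \<and> \<not> int (ram_order S p) dvd l)
      in if \<exists>l. Q l then Some (LEAST l. Q l) else None)"

definition locally_admissible :: "'a::t2_space spectral_data \<Rightarrow> bool" where
  "locally_admissible S \<longleftrightarrow>
     finite (Ram S) \<and>
     (\<forall>p\<in>Ram S. \<exists>s. sval S p = Some s \<and>
        coprime s (int (ram_order S p)) \<and>
        (s \<le> -1 \<or>
         (s \<in> {1..int (ram_order S p) + 1} \<and>
          ([int (ram_order S p) = 1] (mod s) \<or> [int (ram_order S p) = -1] (mod s)))) \<and>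
        sbar S p \<in> {s, s - 1})"


section \<open>Topological recursion\<close>

definition correlators :: "'a::t2_space spectral_data \<Rightarrow> (nat \<Rightarrow> nat \<Rightarrow> 'a ndiff) \<Rightarrow> bool" where
  "correlators S \<omega> \<longleftrightarrow>
     \<omega> 0 1 = om01 S \<and> \<omega> 0 2 = om02 S \<and>
     (\<forall>g n. n \<ge> 1 \<longrightarrow> mero_ndiff (atlas S) n (\<omega> g n) \<and> symmetric_ndiff (atlas S) n (\<omega> g n)) \<and>
     (\<forall>g n. n \<ge> 1 \<and> 2 * int g - 2 + int n > 0 \<longrightarrow>
        (\<forall>fs. set fs \<subseteq> fpoints (atlas S) \<and> length fs = n \<and> snd ` set fs \<inter> Ram S = {} \<longrightarrow>
           ndiff_regular_at (\<omega> g n) fs) \<and>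
        (\<forall>p\<in>Ram S. \<forall>ws. set ws \<subseteq> fpoints (atlas S) \<and> length ws = n - 1 \<and> snd ` set ws \<inter> Ram S = {} \<longrightarrow>
           form_residue (atlas S) p (\<lambda>f. \<omega> g n (f # ws)) = 0))"

text \<open>\<open>\<W>'\<^bsub>g,i;n\<^esub>\<close>, with the variables indexed from 0.\<close>

definition Wprime :: "(nat \<Rightarrow> nat \<Rightarrow> 'a ndiff) \<Rightarrow> nat \<Rightarrow> 'a fpoint list \<Rightarrow> 'a fpoint list \<Rightarrow> complex" where
  "Wprime \<omega> g zs ws =
     (let i = length zs; n = length ws in
      \<Sum>P | partition_on {..<i} P.
      \<Sum>M | M \<in> P \<rightarrow>\<^sub>E Pow {..<n} \<and> disjoint_family_on M P \<and> (\<Union>L\<in>P. M L) = {..<n}.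
      \<Sum>h | h \<in> P \<rightarrow>\<^sub>E (UNIV :: nat set) \<and> int i + (\<Sum>L\<in>P. int (h L) - 1) = int g.
        if \<exists>L\<in>P. h L = 0 \<and> card L + card (M L) = 1 then 0
        else \<Prod>L\<in>P. \<omega> (h L) (card L + card (M L)) (nths zs L @ nths ws (M L)))"

text \<open>
  The choice of \<open>V\<close> and the \<open>U\<^sub>p\<close> above \<open>q\<close>. The \<open>U\<^sub>p\<close> are small in the sense that they are
  simply connected and carry a standard coordinate.
\<close>

definition fibre_nbhds :: "'a::t2_space spectral_data \<Rightarrow> sphere \<Rightarrow> sphere set \<Rightarrow> ('a \<Rightarrow> 'a set) \<Rightarrow> bool" where
  "fibre_nbhds S q V U \<longleftrightarrow>
     open V \<and> simply_connected V \<and> q \<in> V \<and>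
     xmap S -` V = (\<Union>p\<in>xmap S -` {q}. U p) \<and>
     disjoint_family_on U (xmap S -` {q}) \<and>
     (\<forall>p\<in>xmap S -` {q}. p \<in> U p \<and> open (U p) \<and> simply_connected (U p) \<and>
        (\<exists>\<zeta>. standard_coord S p (U p, \<zeta>)))"

text \<open>\<open>\<ff>'\<^sub>P(z)\<close>; the case of a singleton \<open>P\<close> is \<open>\<ff>'\<^sub>p(z)\<close>.\<close>

definition fprime :: "'a spectral_data \<Rightarrow> ('a \<Rightarrow> 'a set) \<Rightarrow> 'a set \<Rightarrow> 'a \<Rightarrow> 'a set" where
  "fprime S U P z = (xmap S -` {xmap S z} \<inter> (\<Union>p\<in>P. U p)) - {z}"

definition primitive_expr :: "('a fpoint \<Rightarrow> 'a \<Rightarrow> complex) \<Rightarrow> 'a coord \<Rightarrow> 'a coord \<Rightarrow> complex list \<Rightarrow> complex" where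
  "primitive_expr \<alpha> c d ts = \<alpha> (c, coord_inv c (ts ! 0)) (coord_inv d (ts ! 1))"

definition primitive_regular_at ::
    "'a::t2_space spectral_data \<Rightarrow> ('a fpoint \<Rightarrow> 'a \<Rightarrow> complex) \<Rightarrow> 'a fpoint \<Rightarrow> 'a \<Rightarrow> bool" where
  "primitive_regular_at S \<alpha> f z \<longleftrightarrow>
     (\<forall>d. (d, z) \<in> fpoints (atlas S) \<longrightarrow>
        holo_near (primitive_expr \<alpha> (fst f) d) [snd (fst f) (snd f), snd d z])"

text \<open>
  A local primitive on \<open>U\<close>: a meromorphic 1-form in the first (framed) variable and a
  meromorphic function in the second one.
\<close>

definition local_primitive ::
    "'a::t2_space spectral_data \<Rightarrow> 'a set \<Rightarrow> ('a fpoint \<Rightarrow> 'a \<Rightarrow> complex) \<Rightarrow> bool" where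
  "local_primitive S U \<alpha> \<longleftrightarrow>
     (\<forall>c w0 d z. (c, w0) \<in> fpoints (atlas S) \<and> (d, z) \<in> fpoints (atlas S) \<and> z \<in> U \<longrightarrow>
        mero_near (primitive_expr \<alpha> c d) [snd c w0, snd d z] \<and>
        (\<forall>c'. (c', w0) \<in> fpoints (atlas S) \<longrightarrow> \<alpha> (c, w0) z = \<alpha> (c', w0) z * coord_deriv c c' w0) \<and>
        (primitive_regular_at S \<alpha> (c, w0) z \<longrightarrow>
           ((\<lambda>t. \<alpha> (c, w0) (coord_inv d t)) has_field_derivative om02 S [(c, w0), (d, z)])
             (at (snd d z))))"

text \<open>\<open>K\<^bsub>1+|Z|\<^esub>(w\<^sub>0; z, Z)\<close>, with the form degree in \<open>z\<close> evaluated at a framed point \<open>f\<close>.\<close>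

definition Kernel ::
    "'a::t2_space spectral_data \<Rightarrow> ('a fpoint \<Rightarrow> 'a \<Rightarrow> complex) \<Rightarrow> 'a fpoint \<Rightarrow> 'a fpoint \<Rightarrow> 'a set \<Rightarrow> complex" where
  "Kernel S \<alpha> w0 f Z =
     - \<alpha> w0 (snd f) / (\<Prod>z'\<in>Z. (yfun S z' - yfun S (snd f)) * dx S f)"

text \<open>
  \<open>\<W>'(z, Z; w)\<close> as a differential in the single variable \<open>z\<close>. Each \<open>z' \<in> Z\<close> is locally a
  holomorphic function of \<open>z\<close> with \<open>x(z') = x(z)\<close>, and the form is pulled back along it: if \<open>d\<close>
  is a coordinate at \<open>z'\<close> then \<open>dd(z') = (dx/dc)(z) / (dx/dd)(z') dc(z)\<close>. The enumeration of
  \<open>Z\<close> is immaterial by symmetry.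
\<close>

definition Wprime_pullback ::
    "'a::t2_space spectral_data \<Rightarrow> (nat \<Rightarrow> nat \<Rightarrow> 'a ndiff) \<Rightarrow> nat \<Rightarrow> 'a fpoint \<Rightarrow> 'a set \<Rightarrow> 'a fpoint list \<Rightarrow> complex" where
  "Wprime_pullback S \<omega> g f Z ws =
     (let framed = (\<lambda>z'. (coord_at (atlas S) z', z'));
          zs = (SOME zs. distinct zs \<and> set zs = Z)
      in Wprime \<omega> g (f # map framed zs) ws * (\<Prod>z'\<in>Z. dx S f / dx S (framed z')))"

text \<open>
  The residue at \<open>p\<close> of the sum over \<open>Z \<subseteq> F(z)\<close> with \<open>|Z| \<ge> 1\<close>, where \<open>F\<close> is one of the
  functions \<open>fprime S U P\<close>, in which case \<open>F(z)\<close> is finite for \<open>z\<close> near \<open>p\<close> and finite \<open>P\<close>.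
\<close>

definition recursion_residue ::
    "'a::t2_space spectral_data \<Rightarrow> (nat \<Rightarrow> nat \<Rightarrow> 'a ndiff) \<Rightarrow> ('a fpoint \<Rightarrow> 'a \<Rightarrow> complex) \<Rightarrow> ('a \<Rightarrow> 'a set)
      \<Rightarrow> nat \<Rightarrow> 'a fpoint \<Rightarrow> 'a fpoint list \<Rightarrow> 'a \<Rightarrow> complex" where
  "recursion_residue S \<omega> \<alpha> F g w0 ws p =
     form_residue (atlas S) p (\<lambda>f.
       \<Sum>Z | Z \<subseteq> F (snd f) \<and> card Z \<ge> 1. Kernel S \<alpha> w0 f Z * Wprime_pullback S \<omega> g f Z ws)"

text \<open>
  An equality of meromorphic differentials in \<open>w\<^sub>0, w\<^sub>1, \<dots>, w\<^sub>n\<close> is stated on the dense open set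
  of those points at which both sides are evidently regular. The sum over all \<open>p \<in> \<Sigma>\<close> is
  finite, as \<open>\<ff>'\<^sub>p\<close> is empty near \<open>p\<close> unless \<open>p\<close> is a ramification point.
\<close>

definition topological_recursion ::
    "'a::t2_space spectral_data \<Rightarrow> (nat \<Rightarrow> nat \<Rightarrow> 'a ndiff) \<Rightarrow> bool" where
  "topological_recursion S \<omega> \<longleftrightarrow>
     (\<exists>V U \<alpha>.
        (\<forall>q\<in>range (xmap S). fibre_nbhds S q (V q) U) \<and>
        (\<forall>p. local_primitive S (U p) (\<alpha> p)) \<and>
        (\<forall>g n. 2 * int g - 2 + (1 + int n) > 0 \<longrightarrow>
           (\<forall>w0 ws. set (w0 # ws) \<subseteq> fpoints (atlas S) \<and> length ws = n \<and>
              snd ` set (w0 # ws) \<inter> Ram S = {} \<and>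
              (\<forall>p\<in>Ram S. primitive_regular_at S (\<alpha> p) w0 p) \<longrightarrow>
              \<omega> g (1 + n) (w0 # ws) =
                Sum_any (\<lambda>p. recursion_residue S \<omega> (\<alpha> p) (fprime S U {p}) g w0 ws p))))"

definition globalisable_over ::
    "'a::t2_space spectral_data \<Rightarrow> (nat \<Rightarrow> nat \<Rightarrow> 'a ndiff) \<Rightarrow> sphere \<Rightarrow> 'a set \<Rightarrow> bool" where
  "globalisable_over S \<omega> q P \<longleftrightarrow>
     (\<forall>V U \<alpha>. fibre_nbhds S q V U \<and> (\<forall>p\<in>P. local_primitive S (U p) (\<alpha> p)) \<longrightarrow>
        (\<forall>g n. 2 * int g - 2 + (1 + int n) > 0 \<longrightarrow>
           (\<forall>w0 ws. set (w0 # ws) \<subseteq> fpoints (atlas S) \<and> length ws = n \<and>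
              snd ` set ws \<inter> (P \<union> Ram S) = {} \<and>
              (\<forall>p\<in>P. primitive_regular_at S (\<alpha> p) w0 p) \<longrightarrow>
              (\<Sum>p\<in>P. recursion_residue S \<omega> (\<alpha> p) (fprime S U {p}) g w0 ws p) =
              (\<Sum>p\<in>P. recursion_residue S \<omega> (\<alpha> p) (fprime S U P) g w0 ws p))))"

end

theory Submission
  imports Defs "HOL-Combinatorics.Permutations"
begin

text \<open>
  Since \<open>x\<close> is unramified above \<open>q\<close>, the sets \<open>\<ff>'\<^sub>p(z)\<close> are empty, so the local sum
  vanishes, and it suffices that every summand of the global one is holomorphic at \<open>p\<close>. Use
  \<open>\<zeta> = x - q\<close> (or \<open>1 / x\<close>) as a coordinate on all sheets at once. As distinct points of the fibre
  are away from each other, from the \<open>w\<^sub>i\<close> and from \<open>Ram\<close>, the factor \<open>\<W>'\<close> is holomorphic. The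
  denominator factors \<open>(y(z') - y(z)) dx(z)\<close> are differences of two expansions of \<open>\<omega>\<^sub>0\<^sub>,\<^sub>1\<close> in
  \<open>\<zeta>\<close>; the conditions on \<open>\<tau>\<close> prevent the leading terms from cancelling and those on the orders
  make the leading exponent nonpositive, so their inverses are holomorphic too.
\<close>

text \<open>The integrand is described through arbitrary choices: the residue at p is taken in the
  chart \<open>coord_at\<close>, each further point z' of the fibre is framed in a chart chosen anew
  for every z', and \<open>Z\<close> is enumerated by \<open>SOME\<close>. So the factors cannot be
  called holomorphic in z as they stand. Symmetry and the transformation law of differentials first
  bring a summand into a form in which only \<zeta> occurs. There dx/d\<zeta>, which is the same
  function on every sheet and has a pole if q is infinite, cancels from the kernel and from the
  pullback of \<open>Wprime\<close>, and a single Jacobian d\<zeta>/dc survives. If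
  \<open>om01\<close> is f d\<zeta> on a sheet, then f has order \<open>sbar - 1\<close>, and a
  denominator factor becomes a difference of two such f, of order one less than the smaller
  \<open>sbar\<close>. Its inverse is holomorphic as soon as one of the two \<open>sbar\<close> is
  at most 1; hence the bound 2 in the hypothesis. Values of meromorphic data at single points are
  conventions, so the integrand is compared with a holomorphic function on a punctured neighbourhood
  only.\<close>

section \<open>Holomorphic functions of several variables along affine curves\<close>

text \<open>In the curves that occur every \<open>k i\<close> is 0 or 1: some variables are frozen
  and the others all equal u. The bound on \<open>k i\<close> sends the disc of radius \<delta>
  about a into the polydisc of the same radius about \<gamma> a.\<close>

lemma cdifferentiable_along_affine_curve:
  fixes \<gamma> :: "complex \<Rightarrow> complex list"
  assumes F: "cdifferentiable_at F (\<gamma> a)"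
    and len: "\<And>u. length (\<gamma> u) = n"
    and aff: "\<And>i u. i < n \<Longrightarrow> \<gamma> u ! i = k i * u + b i"
    and k: "\<And>i. i < n \<Longrightarrow> norm (k i) \<le> 1"
  shows "(\<lambda>u. F (\<gamma> u)) field_differentiable at a"
proof -
  obtain D where D: "\<And>\<epsilon>. \<epsilon> > 0 \<Longrightarrow> \<exists>\<delta>>0. \<forall>t\<in>polydisc (\<gamma> a) \<delta>.
      norm (F t - F (\<gamma> a) - (\<Sum>i<n. D i * (t ! i - \<gamma> a ! i)))
        \<le> \<epsilon> * (\<Sum>i<n. norm (t ! i - \<gamma> a ! i))"
    using F unfolding cdifferentiable_at_def len by metis
  have diff: "\<gamma> u ! i - \<gamma> a ! i = k i * (u - a)" if "i < n" for i u
    using that by (simp add: aff algebra_simps)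
  have "((\<lambda>u. F (\<gamma> u)) has_derivative (\<lambda>h. (\<Sum>i<n. D i * k i) * h)) (at a)"
    unfolding has_derivative_at_alt
  proof (intro conjI allI impI)
    show "bounded_linear (\<lambda>h. (\<Sum>i<n. D i * k i) * h)"
      by (rule bounded_linear_mult_right)
    fix e :: real assume "e > 0"
    \<comment> \<open>Each of the n coordinates contributes at most \<open>norm (u - a)\<close> to
      the error; n + 1 in place of n covers n = 0.\<close>
    then have "e / (real n + 1) > 0" by simp
    from D[OF this] obtain \<delta> where \<delta>: "\<delta> > 0" "\<And>t. t\<in>polydisc (\<gamma> a) \<delta> \<Longrightarrow>
      norm (F t - F (\<gamma> a) - (\<Sum>i<n. D i * (t ! i - \<gamma> a ! i)))
        \<le> e / (real n + 1) * (\<Sum>i<n. norm (t ! i - \<gamma> a ! i))" by blast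
    have "norm (F (\<gamma> u) - F (\<gamma> a) - (\<Sum>i<n. D i * k i) * (u - a)) \<le> e * norm (u - a)"
      if u: "norm (u - a) < \<delta>" for u
    proof -
      have le: "norm (k i * (u - a)) \<le> norm (u - a)" if "i < n" for i
        using k[OF that] by (simp add: norm_mult mult_left_le_one_le)
      have "\<gamma> u \<in> polydisc (\<gamma> a) \<delta>"
        using u le by (fastforce simp: polydisc_def len dist_norm diff)
      from \<delta>(2)[OF this]
      have "norm (F (\<gamma> u) - F (\<gamma> a) - (\<Sum>i<n. D i * k i) * (u - a))
          \<le> e / (real n + 1) * (\<Sum>i<n. norm (k i * (u - a)))"
        by (simp add: diff sum_distrib_right mult.assoc)
      also have "\<dots> \<le> e / (real n + 1) * (\<Sum>i<n. norm (u - a))"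
        using \<open>e > 0\<close> le by (intro mult_left_mono sum_mono) auto
      also have "\<dots> = (real n / (real n + 1)) * (e * norm (u - a))"
        by (simp add: field_simps)
      also have "\<dots> \<le> e * norm (u - a)"
        using \<open>e > 0\<close> by (intro mult_left_le_one_le) auto
      finally show ?thesis .
    qed
    then show "\<exists>d>0. \<forall>y. norm (y - a) < d \<longrightarrow>
      norm (F (\<gamma> y) - F (\<gamma> a) - (\<Sum>i<n. D i * k i) * (y - a)) \<le> e * norm (y - a)"
      using \<delta>(1) by blast
  qed
  then have "((\<lambda>u. F (\<gamma> u)) has_field_derivative (\<Sum>i<n. D i * k i)) (at a)"
    by (simp add: has_field_derivative_def)
  then show ?thesis
    by (auto simp: field_differentiable_def)
qed

lemma analytic_along_affine_curve:
  fixes \<gamma> :: "complex \<Rightarrow> complex list"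
  assumes F: "holo_near F (\<gamma> a)"
    and len: "\<And>u. length (\<gamma> u) = n"
    and aff: "\<And>i u. i < n \<Longrightarrow> \<gamma> u ! i = k i * u + b i"
    and k: "\<And>i. i < n \<Longrightarrow> norm (k i) \<le> 1"
  shows "(\<lambda>u. F (\<gamma> u)) analytic_on {a}"
proof -
  obtain r where r: "r > 0" "\<And>t. t \<in> polydisc (\<gamma> a) r \<Longrightarrow> cdifferentiable_at F t"
    using F by (auto simp: holo_near_def)
  have "\<gamma> u \<in> polydisc (\<gamma> a) r" if "dist u a < r" for u
  proof -
    have "dist (\<gamma> u ! i) (\<gamma> a ! i) < r" if "i < n" for i
    proof -
      have "dist (\<gamma> u ! i) (\<gamma> a ! i) = norm (k i * (u - a))"
        using that by (simp add: aff dist_norm algebra_simps)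
      also have "\<dots> \<le> norm (u - a)"
        using k[OF that] by (simp add: norm_mult mult_left_le_one_le)
      finally show ?thesis using \<open>dist u a < r\<close> by (simp add: dist_norm)
    qed
    then show ?thesis by (simp add: polydisc_def len)
  qed
  then have "(\<lambda>u. F (\<gamma> u)) field_differentiable at u" if "u \<in> ball a r" for u
    using that
    by (intro cdifferentiable_along_affine_curve[OF _ len aff k] r(2)) (auto simp: dist_commute)
  then have "(\<lambda>u. F (\<gamma> u)) holomorphic_on ball a r"
    by (simp add: field_differentiable_at_within holomorphic_on_def)
  then show ?thesis
    using \<open>r > 0\<close> by (meson analytic_at centre_in_ball open_ball)
qed

text \<open>In one variable the zeros of H are isolated, so F equals the quotient G / H off c. In
  the second claim the first alternative includes the centre c and the other does not. In this form
  it shows later that both the points near which a form vanishes and the remaining points form open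
  sets.\<close>

lemma mero_near_one_variable:
  assumes "mero_near F [c]"
  shows "(\<lambda>t. F [t]) meromorphic_on {c}"
    and "(\<exists>\<rho>>0. \<forall>t\<in>ball c \<rho>. F [t] = 0) \<or> (\<exists>\<rho>>0. \<forall>t\<in>ball c \<rho> - {c}. F [t] \<noteq> 0)"
proof -
  obtain r G H where r: "r > 0"
    and GH: "\<forall>t\<in>polydisc [c] r. cdifferentiable_at G t \<and> cdifferentiable_at H t"
    and Hn: "\<exists>t\<in>polydisc [c] r. H t \<noteq> 0"
    and F: "\<forall>t\<in>polydisc [c] r. H t \<noteq> 0 \<longrightarrow> F t = G t / H t"
    and ext: "\<forall>t\<in>polydisc [c] r. \<forall>E. holo_near E t \<and>
       (\<exists>\<rho>>0. \<forall>u\<in>polydisc t \<rho>. H u \<noteq> 0 \<longrightarrow> E u = F u) \<longrightarrow> F t = E t"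
    using assms unfolding mero_near_def by (elim exE conjE) (rule that)
  have pd: "t \<in> polydisc [z] s \<longleftrightarrow> (\<exists>u\<in>ball z s. t = [u])" for t z s
    by (cases t) (auto simp: polydisc_def dist_commute)
  define g where "g = (\<lambda>t. G [t])"
  define h where "h = (\<lambda>t. H [t])"
  have fd: "(\<lambda>u. K [u]) field_differentiable at t" if "cdifferentiable_at K [t]" for K t
    by (rule cdifferentiable_along_affine_curve[where \<gamma> = "\<lambda>u. [u]" and n = 1 and k = "\<lambda>_. 1" and b = "\<lambda>_. 0"])
      (use that in auto)
  have gh: "g holomorphic_on ball c r" "h holomorphic_on ball c r"
    unfolding g_def h_def holomorphic_on_def using GH pd by (auto intro!: field_differentiable_at_within fd)
  have an: "g analytic_on {c}" "h analytic_on {c}"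
    using gh r by (meson analytic_at centre_in_ball open_ball)+
  obtain t0 where t0: "t0 \<in> ball c r" "h t0 \<noteq> 0"
    using Hn pd unfolding h_def by auto
  have hne: "\<forall>\<^sub>F t in at c. h t \<noteq> 0"
  proof -
    have "\<exists>\<rho>>0. \<forall>t\<in>ball c \<rho> - {c}. h t \<noteq> 0"
    proof (cases "h c = 0")
      case True
      then show ?thesis
        using isolated_zeros[OF gh(2), of c t0] t0 r by (metis Diff_iff connected_ball insertI1 open_ball
         centre_in_ball)
    next
      case False
      then show ?thesis
        using analytic_at_imp_isCont[OF an(2)] continuous_at_avoid[of c h 0]
        by (metis DiffD1 mem_ball)
    qed
    then show ?thesis
      by (simp add: eventually_at) (metis Diff_iff dist_commute mem_ball singletonD)
  qed
  have Fev: "\<forall>\<^sub>F t in at c. F [t] = g t / h t"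
  proof -
    have "\<forall>\<^sub>F t in at c. t \<in> ball c r"
      using r by (intro eventually_at_in_open') auto
    with hne show ?thesis
      by eventually_elim (use F pd in \<open>auto simp: g_def h_def\<close>)
  qed
  have "(\<lambda>t. g t / h t) meromorphic_on {c}"
    using an by (intro meromorphic_on_divide analytic_on_imp_meromorphic_on) 
  then show mero: "(\<lambda>t. F [t]) meromorphic_on {c}"
    using meromorphic_on_cong[of "{c}" "\<lambda>t. F [t]" "\<lambda>t. g t / h t" "{c}"] Fev by simp
  show "(\<exists>\<rho>>0. \<forall>t\<in>ball c \<rho>. F [t] = 0) \<or> (\<exists>\<rho>>0. \<forall>t\<in>ball c \<rho> - {c}. F [t] \<noteq> 0)"
  proof (cases "\<forall>\<^sub>F t in at c. F [t] = 0")
    case True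
    then obtain \<rho> where \<rho>: "\<rho> > 0" "\<And>t. t \<noteq> c \<Longrightarrow> dist t c < \<rho> \<Longrightarrow> F [t] = 0"
      by (auto simp: eventually_at)
    have "F [c] = 0"
    proof (cases "h c = 0")
      case True
      \<comment> \<open>Where H vanishes the quotient says nothing about F at c. The last clause of
        \<open>mero_near\<close>, applied to the extension E = 0, fixes the value.\<close>
      have "F [c] = (\<lambda>_. 0) [c]"
      proof (rule ext[rule_format, OF _ conjI])
        show "[c] \<in> polydisc [c] r" using r by (simp add: polydisc_def)
        have "cdifferentiable_at (\<lambda>_. 0) t" for t
          unfolding cdifferentiable_at_def
          by (rule exI[of _ "\<lambda>_. 0"]) (auto intro!: exI[of _ 1] sum_nonneg mult_nonneg_nonneg)
        then show "holo_near (\<lambda>_. 0) [c]"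
          by (auto simp: holo_near_def intro: exI[of _ 1])
        have "0 = F u" if u: "u \<in> polydisc [c] \<rho>" "H u \<noteq> 0" for u
        proof -
          obtain v where "v \<in> ball c \<rho>" "u = [v]" using u pd by blast
          then show ?thesis using \<rho>(2)[of v] u True by (auto simp: h_def dist_commute)
        qed
        then show "\<exists>\<rho>>0. \<forall>u\<in>polydisc [c] \<rho>. H u \<noteq> 0 \<longrightarrow> 0 = F u"
          using \<rho>(1) by blast
      qed
      then show ?thesis by simp
    next
      case False
      then have "isCont (\<lambda>t. g t / h t) c"
        using an by (intro continuous_intros analytic_at_imp_isCont)
      then have "((\<lambda>t. g t / h t) \<longlongrightarrow> g c / h c) (at c)"
        by (simp add: isCont_def)
      moreover have "\<forall>\<^sub>F t in at c. g t / h t = 0"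
        using Fev True by eventually_elim simp
      ultimately have "g c / h c = 0"
        using tendsto_unique[OF at_neq_bot _ tendsto_eventually] by blast
      then show ?thesis using F False r pd by (auto simp: g_def h_def polydisc_def)
    qed
    then show ?thesis using \<rho> by (metis dist_commute mem_ball)
  next
    case False
    then have "\<forall>\<^sub>F t in at c. F [t] \<noteq> 0"
      using mero not_essential_frequently_0_imp_eventually_0[of "\<lambda>t. F [t]" c]
      by (auto simp: meromorphic_at_iff frequently_def)
    then show ?thesis
      by (simp add: eventually_at) (metis Diff_iff dist_commute mem_ball singletonI)
  qed
qed

section \<open>Local coordinates\<close>

lemma complex_atlasD:
  assumes "complex_atlas A"
  shows complex_atlas_subset: "A \<subseteq> local_coords A"
    and complex_atlas_cover: "\<exists>a\<in>A. z \<in> fst a"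
    and complex_atlas_homeomorphism: "a \<in> A \<Longrightarrow> homeomorphism (fst a) (snd a ` fst a) (snd a) (coord_inv a)"
    and complex_atlas_open: "a \<in> A \<Longrightarrow> open (fst a)" "a \<in> A \<Longrightarrow> open (snd a ` fst a)"
proof -
  note * = assms[unfolded complex_atlas_def]
  show "\<exists>a\<in>A. z \<in> fst a" using * by blast
  show h: "homeomorphism (fst a) (snd a ` fst a) (snd a) (coord_inv a)" if "a \<in> A" for a
    using * that by blast
  show "a \<in> A \<Longrightarrow> open (fst a)" "a \<in> A \<Longrightarrow> open (snd a ` fst a)" using * by blast+
  have "inj_on (snd a) (fst a)" if "a \<in> A" for a
    by (rule inj_on_inverseI) (rule homeomorphism_apply1[OF h[OF that]])
  moreover have "open (fst a)" "\<forall>d\<in>A. (snd a \<circ> coord_inv d) holomorphic_on snd d ` (fst a \<inter> fst d)"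
    if "a \<in> A" for a
    using * that by (auto simp: Int_commute)
  ultimately show "A \<subseteq> local_coords A"
    unfolding local_coords_def by blast
qed

lemma local_coordsD:
  assumes "c \<in> local_coords A"
  shows "open (fst c)" "inj_on (snd c) (fst c)" "z \<in> fst c \<Longrightarrow> coord_inv c (snd c z) = z"
  using assms by (auto simp: local_coords_def)

lemma coord_at_in:
  assumes "complex_atlas A"
  shows "coord_at A p \<in> local_coords A" "p \<in> fst (coord_at A p)"
proof -
  have "\<exists>c. c \<in> local_coords A \<and> p \<in> fst c"
    using complex_atlasD(1,2)[OF assms] by blast
  from someI_ex[OF this] show "coord_at A p \<in> local_coords A" "p \<in> fst (coord_at A p)"
    by (auto simp: coord_at_def)
qed

lemma open_atlas_image:
  assumes "complex_atlas A" "a \<in> A" "open W" "W \<subseteq> fst a"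
  shows "open (snd a ` W)"
proof -
  have "openin (top_of_set (snd a ` fst a)) (snd a ` W)"
    using complex_atlas_homeomorphism[OF assms(1,2)] assms
    by (meson homeomorphism_imp_open_map open_subset)
  then show ?thesis
    using complex_atlas_open(2)[OF assms(1,2)] openin_open_trans by blast
qed

lemma inj_on_coord_comp:
  assumes "complex_atlas A" "a \<in> A" "c \<in> local_coords A" "W \<subseteq> fst a" "W \<subseteq> fst c"
  shows "inj_on (snd c \<circ> coord_inv a) (snd a ` W)"
proof -
  have "coord_inv a (snd a z) = z" if "z \<in> W" for z
    using local_coordsD(3)[of a A] complex_atlas_subset[OF assms(1)] assms(2,4) that by blast
  moreover have "inj_on (snd c) W"
    using local_coordsD(2)[OF assms(3)] assms(5) by (rule inj_on_subset)
  ultimately show ?thesis by (auto simp: inj_on_def)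
qed

text \<open>\<open>local_coords\<close> asks only for an injective function that is holomorphic in
  the charts of the atlas. Openness of its images is the open mapping theorem, applied in each
  chart.\<close>

lemma open_coord_image:
  assumes A: "complex_atlas A" and c: "c \<in> local_coords A" and W: "open W" "W \<subseteq> fst c"
  shows "open (snd c ` W)"
proof -
  have "(snd c \<circ> coord_inv a) ` (snd a ` (W \<inter> fst a)) = snd c ` (W \<inter> fst a)" if "a \<in> A" for a
    using local_coordsD(3)[OF subsetD[OF complex_atlas_subset[OF A] that]]
    by (force simp: image_image)
  moreover have "snd c ` W = (\<Union>a\<in>A. snd c ` (W \<inter> fst a))"
    using complex_atlas_cover[OF A] by blast
  ultimately have "snd c ` W = (\<Union>a\<in>A. (snd c \<circ> coord_inv a) ` (snd a ` (W \<inter> fst a)))"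
    by simp
  also have "open \<dots>"
  proof (intro open_UN ballI open_mapping_thm3)
    fix a assume a: "a \<in> A"
    show "(snd c \<circ> coord_inv a) holomorphic_on snd a ` (W \<inter> fst a)"
      using c a W by (auto simp: local_coords_def intro: holomorphic_on_subset image_mono)
    show "open (snd a ` (W \<inter> fst a))"
      using open_atlas_image[OF A a] W complex_atlas_open(1)[OF A a] by auto
    show "inj_on (snd c \<circ> coord_inv a) (snd a ` (W \<inter> fst a))"
      using A W by (intro inj_on_coord_comp[OF A a c]) auto
  qed
  finally show ?thesis .
qed

lemma continuous_on_coord:
  assumes A: "complex_atlas (A :: 'a::t2_space coord set)" and c: "c \<in> local_coords A"
  shows "continuous_on (fst c) (snd c)"
proof (intro continuous_at_imp_continuous_on ballI)
  fix z assume z: "z \<in> fst c"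
  obtain a where a: "a \<in> A" "z \<in> fst a" using complex_atlas_cover[OF A] by blast
  let ?W = "fst a \<inter> fst c"
  have o: "open ?W" using complex_atlas_open(1)[OF A a(1)] local_coordsD(1)[OF c] by auto
  have "continuous_on (snd a ` ?W) (snd c \<circ> coord_inv a)"
    using c a by (intro holomorphic_on_imp_continuous_on) (simp add: local_coords_def Int_commute)
  moreover have "continuous_on ?W (snd a)"
    using complex_atlas_homeomorphism[OF A a(1)] continuous_on_subset
    by (metis homeomorphism_def inf_le1)
  ultimately have "continuous_on ?W ((snd c \<circ> coord_inv a) \<circ> snd a)"
    using continuous_on_compose by blast
  moreover have "continuous_on ?W ((snd c \<circ> coord_inv a) \<circ> snd a) \<longleftrightarrow> continuous_on ?W (snd c)"
    using local_coordsD(3)[of a A] complex_atlas_subset[OF A] a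
    by (intro continuous_on_cong) auto
  ultimately show "isCont (snd c) z"
    using o z a by (simp add: continuous_on_eq_continuous_at)
qed

text \<open>Near each point the transition factors through a chart a of the atlas, as the expression
  of d in a after the inverse of the expression of c in a. The inverse of an injective holomorphic
  function is holomorphic.\<close>

lemma transition_holomorphic:
  assumes A: "complex_atlas A" and c: "c \<in> local_coords A" and d: "d \<in> local_coords A"
  shows "(snd d \<circ> coord_inv c) holomorphic_on snd c ` (fst c \<inter> fst d)"
proof -
  have "(snd d \<circ> coord_inv c) field_differentiable at (snd c z)" if z: "z \<in> fst c \<inter> fst d" for z
  proof -
    obtain a where a: "a \<in> A" "z \<in> fst a" using complex_atlas_cover[OF A] by blast
    note inv = local_coordsD(3)[OF subsetD[OF complex_atlas_subset[OF A] a(1)]]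
    define W where "W = fst a \<inter> fst c \<inter> fst d"
    have W: "open W" "W \<subseteq> fst a" "W \<subseteq> fst c" "W \<subseteq> fst d" "z \<in> W"
      using complex_atlas_open(1)[OF A a(1)] local_coordsD(1)[OF c] local_coordsD(1)[OF d] z a
      by (auto simp: W_def)
    have hol: "(snd e \<circ> coord_inv a) holomorphic_on snd a ` W" if "e \<in> {c, d}" for e
    proof (rule holomorphic_on_subset)
      show "(snd e \<circ> coord_inv a) holomorphic_on snd a ` (fst e \<inter> fst a)"
        using that c d a by (auto simp: local_coords_def)
      show "snd a ` W \<subseteq> snd a ` (fst e \<inter> fst a)"
        using that W by blast
    qed
    obtain g where g: "g holomorphic_on (snd c \<circ> coord_inv a) ` snd a ` W"
        "\<And>t. t \<in> snd a ` W \<Longrightarrow> g ((snd c \<circ> coord_inv a) t) = t"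
      using holomorphic_has_inverse[OF hol[OF insertI1] open_atlas_image[OF A a(1) W(1,2)]
          inj_on_coord_comp[OF A a(1) c W(2,3)]] by metis
    have im: "(snd c \<circ> coord_inv a) ` snd a ` W = snd c ` W"
      using inv W by (auto simp: image_iff subset_iff)
    have gc: "g (snd c w) = snd a w" if "w \<in> W" for w
      using g(2)[of "snd a w"] that W inv by auto
    have "((snd d \<circ> coord_inv a) \<circ> g) holomorphic_on snd c ` W"
      using g(1) hol[of d] gc unfolding im by (intro holomorphic_on_compose_gen) auto
    moreover have "((snd d \<circ> coord_inv a) \<circ> g) t = (snd d \<circ> coord_inv c) t" if "t \<in> snd c ` W" for t
      using that gc inv W local_coordsD(3)[OF c] by (auto simp: subset_iff)
    ultimately have "(snd d \<circ> coord_inv c) holomorphic_on snd c ` W"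
      using holomorphic_cong by metis
    then show ?thesis
      using open_coord_image[OF A c W(1,3)] W(5) holomorphic_on_imp_differentiable_at by blast
  qed
  note diff = this
  show ?thesis
    unfolding holomorphic_on_def
  proof
    fix t assume "t \<in> snd c ` (fst c \<inter> fst d)"
    then obtain z where "z \<in> fst c \<inter> fst d" "t = snd c z" by blast
    then show "(snd d \<circ> coord_inv c) field_differentiable at t within snd c ` (fst c \<inter> fst d)"
      using diff[of z] field_differentiable_at_within by blast
  qed
qed

lemma eventually_coord_inv:
  assumes A: "complex_atlas A" and c: "c \<in> local_coords A" and W: "open W" "z \<in> fst c" "z \<in> W"
  shows "\<forall>\<^sub>F t in nhds (snd c z). coord_inv c t \<in> W \<inter> fst c \<and> snd c (coord_inv c t) = t"
proof -
  have "open (snd c ` (W \<inter> fst c))"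
    using W local_coordsD(1)[OF c] by (intro open_coord_image[OF A c]) auto
  then have "\<forall>\<^sub>F t in nhds (snd c z). t \<in> snd c ` (W \<inter> fst c)"
    using W by (intro eventually_nhds_in_open) auto
  then show ?thesis
    by eventually_elim (use local_coordsD(3)[OF c] in auto)
qed

lemma analytic_transition:
  assumes A: "complex_atlas A" and c: "c \<in> local_coords A" and d: "d \<in> local_coords A"
    and z: "z \<in> fst c" "z \<in> fst d"
  shows "(snd d \<circ> coord_inv c) analytic_on {snd c z}"
proof -
  have "open (snd c ` (fst c \<inter> fst d))"
    using local_coordsD(1)[OF c] local_coordsD(1)[OF d] by (intro open_coord_image[OF A c]) auto
  then show ?thesis
    using transition_holomorphic[OF A c d] z unfolding analytic_at by blast
qed

text \<open>Stated for a function f rather than a coordinate: \<open>f = snd e\<close> gives the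
  cocycle rule for \<open>coord_deriv\<close>, and \<open>f = fin_part \<circ> xmap S\<close> the
  transformation of \<open>dx\<close>.\<close>

lemma deriv_change_coord:
  assumes A: "complex_atlas A" and c: "c \<in> local_coords A" and d: "d \<in> local_coords A"
    and z: "z \<in> fst c" "z \<in> fst d"
    and f: "(f \<circ> coord_inv d) field_differentiable at (snd d z)"
  shows "deriv (f \<circ> coord_inv c) (snd c z) = deriv (f \<circ> coord_inv d) (snd d z) * coord_deriv c d z"
proof -
  have tr: "(snd d \<circ> coord_inv c) field_differentiable at (snd c z)"
    using analytic_transition[OF A c d z] analytic_on_imp_differentiable_at by blast
  have ev: "\<forall>\<^sub>F t in nhds (snd c z). (f \<circ> coord_inv c) t = ((f \<circ> coord_inv d) \<circ> (snd d \<circ> coord_inv c)) t"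
    using eventually_coord_inv[OF A c local_coordsD(1)[OF d] z]
    by eventually_elim (use local_coordsD(3)[OF d] in auto)
  have *: "(snd d \<circ> coord_inv c) (snd c z) = snd d z"
    using local_coordsD(3)[OF c] z by simp
  have "deriv (f \<circ> coord_inv c) (snd c z) = deriv ((f \<circ> coord_inv d) \<circ> (snd d \<circ> coord_inv c)) (snd c z)"
    by (rule deriv_cong_ev[OF ev refl])
  also have "\<dots> = deriv (f \<circ> coord_inv d) (snd d z) * coord_deriv c d z"
    using tr f * by (subst deriv_chain) (auto simp: coord_deriv_def)
  finally show ?thesis .
qed

lemma coord_deriv_trans:
  assumes A: "complex_atlas A" and "c \<in> local_coords A" "d \<in> local_coords A" "e \<in> local_coords A"
    and "z \<in> fst c" "z \<in> fst d" "z \<in> fst e"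
  shows "coord_deriv c d z * coord_deriv d e z = coord_deriv c e z"
  using deriv_change_coord[OF assms(1-3) assms(5,6), of "snd e"]
    analytic_on_imp_differentiable_at[OF analytic_transition[OF A assms(3,4,6,7)]]
  by (simp add: coord_deriv_def mult.commute)

lemma coord_deriv_self:
  assumes A: "complex_atlas A" and c: "c \<in> local_coords A" and z: "z \<in> fst c"
  shows "coord_deriv c c z = 1"
proof -
  have "\<forall>\<^sub>F t in nhds (snd c z). (snd c \<circ> coord_inv c) t = t"
    using eventually_coord_inv[OF A c local_coordsD(1)[OF c] z z] by eventually_elim simp
  then show ?thesis
    unfolding coord_deriv_def by (subst deriv_cong_ev[where g = "\<lambda>t. t"]) auto
qed

lemma coord_deriv_nonzero:
  assumes A: "complex_atlas A" and "c \<in> local_coords A" "d \<in> local_coords A" "z \<in> fst c" "z \<in> fst d"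
  shows "coord_deriv c d z \<noteq> 0"
  using coord_deriv_trans[OF assms(1,2,3,2,4,5,4)] coord_deriv_self[OF assms(1,2,4)] by auto

section \<open>The sum over set partitions\<close>

lemma nths_conv_map_nth: "nths xs I = map ((!) xs) (filter (\<lambda>i. i \<in> I) [0..<length xs])"
proof -
  have "zip xs [0..<length xs] = map (\<lambda>i. (xs ! i, i)) [0..<length xs]"
    by (rule nth_equalityI) auto
  then show ?thesis
    by (simp add: nths_def filter_map o_def)
qed

lemma mset_nths:
  assumes "I \<subseteq> {..<length xs}"
  shows "mset (nths xs I) = image_mset ((!) xs) (mset_set I)"
proof -
  have "mset (filter (\<lambda>i. i \<in> I) [0..<length xs]) = mset_set (set (filter (\<lambda>i. i \<in> I) [0..<length xs]))"
    by (intro mset_set_set[symmetric]) simp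
  also have "set (filter (\<lambda>i. i \<in> I) [0..<length xs]) = I"
    using assms by auto
  finally show ?thesis
    by (simp add: nths_conv_map_nth)
qed

lemma length_nths_subset:
  assumes "I \<subseteq> {..<length xs}"
  shows "length (nths xs I) = card I"
  using assms by (auto simp: length_nths intro!: arg_cong[where f = card])

lemma prod_list_map_nths:
  fixes f :: "'b \<Rightarrow> 'c::comm_monoid_mult"
  assumes "I \<subseteq> {..<length xs}"
  shows "prod_list (map f (nths xs I)) = (\<Prod>i\<in>I. f (xs ! i))"
proof -
  have "prod_list (map f (nths xs I)) = prod_mset (image_mset f (mset (nths xs I)))"
    by (simp add: prod_mset_prod_list[symmetric] del: prod_mset_prod_list)
  also have "\<dots> = (\<Prod>i\<in>I. f (xs ! i))"
    by (simp add: mset_nths[OF assms] prod_unfold_prod_mset image_mset.compositionality o_def)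
  finally show ?thesis .
qed

text \<open>Serves for both inner sums of \<open>Wprime\<close>, over M and over h, when the blocks
  that index them are moved by a permutation. \<open>restrict\<close> is needed since
  \<open>h \<circ> e\<close> need not be \<open>undefined\<close> off P'.\<close>

lemma sum_PiE_reindex:
  assumes e: "bij_betw e P' P"
    and Q: "\<And>h. h \<in> P \<rightarrow>\<^sub>E B \<Longrightarrow> Q h \<longleftrightarrow> Q' (restrict (h \<circ> e) P')"
    and F: "\<And>h. h \<in> P \<rightarrow>\<^sub>E B \<Longrightarrow> Q h \<Longrightarrow> F h = F' (restrict (h \<circ> e) P')"
  shows "(\<Sum>h | h \<in> P \<rightarrow>\<^sub>E B \<and> Q h. F h) = (\<Sum>h | h \<in> P' \<rightarrow>\<^sub>E B \<and> Q' h. F' h)"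
proof -
  define k where "k = inv_into P' e"
  have k: "\<And>x. x \<in> P' \<Longrightarrow> k (e x) = x" "\<And>y. y \<in> P \<Longrightarrow> e (k y) = y" "\<And>y. y \<in> P \<Longrightarrow> k y \<in> P'"
      "\<And>x. x \<in> P' \<Longrightarrow> e x \<in> P"
    using e unfolding k_def
    by (auto simp: bij_betw_inv_into_left bij_betw_inv_into_right bij_betw_def inv_into_into)
  have 1: "restrict (h \<circ> e) P' \<in> P' \<rightarrow>\<^sub>E B" "restrict (restrict (h \<circ> e) P' \<circ> k) P = h"
    if "h \<in> P \<rightarrow>\<^sub>E B" for h
    using that k by (auto simp: PiE_iff extensional_def restrict_def fun_eq_iff)
  have 2: "restrict (h \<circ> k) P \<in> P \<rightarrow>\<^sub>E B" "restrict (restrict (h \<circ> k) P \<circ> e) P' = h"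
    if "h \<in> P' \<rightarrow>\<^sub>E B" for h
    using that k by (auto simp: PiE_iff extensional_def restrict_def fun_eq_iff)
  show ?thesis
    by (rule sum.reindex_bij_witness[of _ "\<lambda>h. restrict (h \<circ> k) P" "\<lambda>h. restrict (h \<circ> e) P'"])
      (use 1 2 Q F in auto)
qed

lemma bij_betw_image_permutes:
  assumes "p permutes A" "P \<subseteq> Pow A"
  shows "bij_betw ((`) p) P ((`) p ` P)"
  using permutes_inj[OF assms(1)] by (intro bij_betw_imageI) (auto simp: inj_on_def inj_image_eq_iff)

lemma partition_on_permutes:
  assumes "p permutes A" "partition_on A P"
  shows "partition_on A ((`) p ` P)"
proof -
  have "partition_on (p ` A) ((`) p ` P - {{}})"
    using assms permutes_inj_on by (intro partition_on_inj_image) blast+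
  moreover have "{} \<notin> (`) p ` P"
    using partition_onD3[OF assms(2)] by auto
  ultimately show ?thesis
    by (simp add: permutes_image[OF assms(1)])
qed

lemma Wprime_permute:
  assumes p: "p permutes {..<length zs}"
    and sym: "\<And>g n. n \<ge> 1 \<Longrightarrow> symmetric_ndiff A n (\<omega> g n)"
    and fp: "set zs \<subseteq> fpoints A" "set ws \<subseteq> fpoints A"
  shows "Wprime \<omega> g (permute_list p zs) ws = Wprime \<omega> g zs ws"
proof -
  let ?n = "length zs" and ?m = "length ws"
  let ?zs = "permute_list p zs"
  have nths: "mset (nths ?zs L) = mset (nths zs (p ` L))" if L: "L \<subseteq> {..<?n}" for L
  proof -
    have "p ` L \<subseteq> {..<?n}" using L permutes_image[OF p] by blast
    then have "mset (nths zs (p ` L)) = image_mset ((!) zs) (mset_set (p ` L))"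
      by (rule mset_nths)
    also have "mset_set (p ` L) = image_mset p (mset_set L)"
      by (rule image_mset_mset_set[symmetric]) (rule permutes_inj_on[OF p])
    also have "image_mset ((!) zs) \<dots> = image_mset ((!) ?zs) (mset_set L)"
    proof -
      have "finite L" using L finite_subset by blast
      then show ?thesis
        using L permute_list_nth[OF p]
        by (auto simp: image_mset.compositionality o_def intro!: image_mset_cong)
    qed
    also have "\<dots> = mset (nths ?zs L)"
      using L by (intro mset_nths[symmetric]) simp
    finally show ?thesis ..
  qed
  have factor: "\<omega> h (card L + card M) (nths ?zs L @ nths ws M)
      = \<omega> h (card (p ` L) + card M) (nths zs (p ` L) @ nths ws M)"
    if L: "L \<subseteq> {..<?n}" "L \<noteq> {}" and M: "M \<subseteq> {..<?m}" for h L M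
  proof -
    have "finite L" using L finite_subset by blast
    then have c: "card (p ` L) = card L" "card L \<ge> 1"
      using L by (auto simp: card_image permutes_inj_on[OF p] Suc_le_eq card_gt_0_iff)
    have "length (nths ?zs L @ nths ws M) = card L + card M"
      using L M by (simp add: length_nths_subset)
    moreover have "set (nths ?zs L @ nths ws M) \<subseteq> fpoints A"
      using fp set_nths_subset[of ?zs L] set_nths_subset[of ws M] p by auto
    moreover have "mset (nths ?zs L @ nths ws M) = mset (nths zs (p ` L) @ nths ws M)"
      using nths[OF L(1)] by simp
    ultimately show ?thesis
      using sym[of "card L + card M" h] c unfolding symmetric_ndiff_def by auto
  qed
  let ?e = "(`) p"
  let ?T = "\<lambda>zs P. \<Sum>M | M \<in> P \<rightarrow>\<^sub>E Pow {..<?m} \<and> disjoint_family_on M P \<and> (\<Union>L\<in>P. M L) = {..<?m}.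
      \<Sum>h | h \<in> P \<rightarrow>\<^sub>E (UNIV :: nat set) \<and> int ?n + (\<Sum>L\<in>P. int (h L) - 1) = int g.
        if \<exists>L\<in>P. h L = 0 \<and> card L + card (M L) = 1 then 0
        else \<Prod>L\<in>P. \<omega> (h L) (card L + card (M L)) (nths zs L @ nths ws (M L))"
  have inner: "?T zs (?e ` P) = ?T ?zs P" if P: "partition_on {..<?n} P" for P
  proof -
    have PL: "L \<subseteq> {..<?n}" "L \<noteq> {}" if "L \<in> P" for L
      using P that partition_onD1[OF P] partition_onD3[OF P] by auto
    have b: "bij_betw ?e P (?e ` P)"
      using PL by (intro bij_betw_image_permutes[OF p]) auto
    have cd: "card (p ` L) = card L" for L
      by (simp add: card_image permutes_inj_on[OF p])
    have pi: "(p ` L = p ` L') = (L = L')" for L L'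
      by (rule inj_image_eq_iff) (rule permutes_inj[OF p])
    show ?thesis
    proof (rule sum_PiE_reindex[OF b], goal_cases)
      case (1 M)
      show ?case
        by (simp add: disjoint_family_on_def pi)
    next
      case (2 M)
      show ?case
      proof (rule sum_PiE_reindex[OF b], goal_cases)
        case (1 h)
        show ?case
          by (simp add: sum.reindex_bij_betw[OF b, symmetric])
      next
        case (2 h)
        have "(\<Prod>L\<in>?e ` P. \<omega> (h L) (card L + card (M L)) (nths zs L @ nths ws (M L)))
           = (\<Prod>L\<in>P. \<omega> (h (p ` L)) (card (p ` L) + card (M (p ` L))) (nths zs (p ` L) @ nths ws (M (p ` L))))"
          by (simp add: prod.reindex_bij_betw[OF b, symmetric])
        also have "\<dots> = (\<Prod>L\<in>P. \<omega> (h (p ` L)) (card L + card (M (p ` L))) (nths ?zs L @ nths ws (M (p ` L))))"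
        proof (rule prod.cong[OF refl])
          fix L assume "L \<in> P"
          moreover from this \<open>M \<in> ?e ` P \<rightarrow>\<^sub>E Pow {..<?m}\<close> have "M (p ` L) \<subseteq> {..<?m}"
            by auto
          ultimately show "\<omega> (h (p ` L)) (card (p ` L) + card (M (p ` L))) (nths zs (p ` L) @ nths ws (M (p ` L)))
              = \<omega> (h (p ` L)) (card L + card (M (p ` L))) (nths ?zs L @ nths ws (M (p ` L)))"
            using factor PL by presburger
        qed
        finally show ?case
          by (auto simp: cd)
      qed
    qed
  qed
  have "(\<Sum>P | partition_on {..<?n} P. ?T ?zs P) = (\<Sum>P | partition_on {..<?n} P. ?T zs P)"
  proof (rule sum.reindex_bij_witness[of _ "\<lambda>P. (`) (inv p) ` P" "\<lambda>P. ?e ` P"], goal_cases)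
    case (1 P)
    show ?case
      by (simp add: image_image permutes_inverses(2)[OF p])
  next
    case (2 P)
    then show ?case using partition_on_permutes[OF p] by simp
  next
    case (3 P)
    show ?case
      by (simp add: image_image permutes_inverses(1)[OF p])
  next
    case (4 P)
    then show ?case using partition_on_permutes[OF permutes_inv[OF p]] by simp
  next
    case (5 P)
    then show ?case using inner by simp
  qed
  then show ?thesis
    by (simp add: Wprime_def Let_def)
qed

text \<open>Makes the enumeration picked by \<open>SOME\<close> in \<open>Wprime_pullback\<close>
  immaterial.\<close>

lemma Wprime_cong_mset:
  assumes "mset zs = mset zs'"
    and "\<And>g n. n \<ge> 1 \<Longrightarrow> symmetric_ndiff A n (\<omega> g n)"
    and "set zs \<subseteq> fpoints A" "set ws \<subseteq> fpoints A"
  shows "Wprime \<omega> g zs ws = Wprime \<omega> g zs' ws"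
proof -
  obtain p where "p permutes {..<length zs}" "permute_list p zs = zs'"
    using mset_eq_permutation[OF assms(1)[symmetric]] by blast
  then show ?thesis
    using Wprime_permute[where p = p and zs = zs and A = A and \<omega> = \<omega> and ws = ws and g = g, OF _ assms(2-4)] by simp
qed

section \<open>\<open>Wprime\<close> under a change of local coordinates, and its holomorphy along
  the sheets\<close>

lemma mero_ndiff_change_coords:
  assumes A: "complex_atlas A"
    and \<omega>: "mero_ndiff A (length ks + length ws) \<omega>"
    and cz: "\<And>k. k \<in> set ks \<Longrightarrow> (c k, z k) \<in> fpoints A"
    and dz: "\<And>k. k \<in> set ks \<Longrightarrow> (d k, z k) \<in> fpoints A"
    and ws: "set ws \<subseteq> fpoints A"
  shows "\<omega> (map (\<lambda>k. (c k, z k)) ks @ ws)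
    = \<omega> (map (\<lambda>k. (d k, z k)) ks @ ws) * prod_list (map (\<lambda>k. coord_deriv (c k) (d k) (z k)) ks)"
proof -
  let ?fs = "map (\<lambda>k. (c k, z k)) ks @ ws" and ?ds = "map d ks @ map fst ws"
  let ?n = "length ks + length ws"
  have zip: "zip ?ds (map snd ?fs) = map (\<lambda>k. (d k, z k)) ks @ ws"
    by (rule nth_equalityI) (auto simp: nth_append)
  have sub: "set ?fs \<subseteq> fpoints A" "set (zip ?ds (map snd ?fs)) \<subseteq> fpoints A"
    unfolding zip using cz dz ws by auto
  moreover have len: "length ?fs = ?n" "length ?ds = ?n"
    by simp_all
  ultimately have "\<omega> ?fs = \<omega> (zip ?ds (map snd ?fs)) * (\<Prod>i<?n. coord_deriv (fst (?fs ! i)) (?ds ! i) (snd (?fs ! i)))"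
    using \<omega> len unfolding mero_ndiff_def by blast
  \<comment> \<open>The entries of \<open>ws\<close> keep their coordinates, so their positions
    contribute the factor 1 of \<open>coord_deriv_self\<close>.\<close>
  also have "(\<Prod>i<?n. coord_deriv (fst (?fs ! i)) (?ds ! i) (snd (?fs ! i)))
      = prod_list (map (\<lambda>k. coord_deriv (c k) (d k) (z k)) ks @ map (\<lambda>_. 1) ws)"
    unfolding prod.list_conv_set_nth
  proof (rule prod.cong)
    fix i assume i: "i \<in> {0..<length (map (\<lambda>k. coord_deriv (c k) (d k) (z k)) ks @ map (\<lambda>_. 1 :: complex) ws)}"
    show "coord_deriv (fst (?fs ! i)) (?ds ! i) (snd (?fs ! i))
        = (map (\<lambda>k. coord_deriv (c k) (d k) (z k)) ks @ map (\<lambda>_. 1) ws) ! i"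
    proof (cases "i < length ks")
      case False
      then have "ws ! (i - length ks) \<in> fpoints A"
        using ws i by (intro subsetD[OF ws] nth_mem) auto
      then show ?thesis
        using False i coord_deriv_self[OF A] by (auto simp: nth_append fpoints_def)
    qed (use i in \<open>simp add: nth_append\<close>)
  qed auto
  finally show ?thesis
    unfolding zip by (simp add: map_replicate_const)
qed

text \<open>Each index lies in exactly one block, so the Jacobians of the blocks multiply to the
  same total for every P, M and h, and that total can be taken out of the sum.\<close>

lemma Wprime_change_coords:
  assumes A: "complex_atlas A"
    and \<omega>: "\<And>g n. n \<ge> 1 \<Longrightarrow> mero_ndiff A n (\<omega> g n)"
    and cz: "\<And>k. k \<in> set ks \<Longrightarrow> (c k, z k) \<in> fpoints A"
    and dz: "\<And>k. k \<in> set ks \<Longrightarrow> (d k, z k) \<in> fpoints A"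
    and ws: "set ws \<subseteq> fpoints A"
  shows "Wprime \<omega> g (map (\<lambda>k. (c k, z k)) ks) ws
    = Wprime \<omega> g (map (\<lambda>k. (d k, z k)) ks) ws * prod_list (map (\<lambda>k. coord_deriv (c k) (d k) (z k)) ks)"
proof -
  let ?cd = "\<lambda>k. coord_deriv (c k) (d k) (z k)"
  have "(\<Prod>L\<in>P. \<omega> (h L) (card L + card (M L)) (nths (map (\<lambda>k. (c k, z k)) ks) L @ nths ws (M L)))
     = (\<Prod>L\<in>P. \<omega> (h L) (card L + card (M L)) (nths (map (\<lambda>k. (d k, z k)) ks) L @ nths ws (M L)))
       * prod_list (map ?cd ks)"
    if P: "partition_on {..<length ks} P" and M: "M \<in> P \<rightarrow>\<^sub>E Pow {..<length ws}" for P M h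
  proof -
    have "\<omega> (h L) (card L + card (M L)) (nths (map (\<lambda>k. (c k, z k)) ks) L @ nths ws (M L))
       = \<omega> (h L) (card L + card (M L)) (nths (map (\<lambda>k. (d k, z k)) ks) L @ nths ws (M L))
         * (\<Prod>i\<in>L. ?cd (ks ! i))"
      if "L \<in> P" for L
    proof -
      have L: "L \<subseteq> {..<length ks}" "L \<noteq> {}" and MI: "M L \<subseteq> {..<length ws}"
        using that partition_onD1[OF P] partition_onD3[OF P] PiE_mem[OF M that] by blast+
      have "finite L" using L finite_subset by blast
      then have n: "card L + card (M L) \<ge> 1" using L by (simp add: Suc_le_eq card_gt_0_iff)
      have len: "card L + card (M L) = length (nths ks L) + length (nths ws (M L))"
        using L MI by (simp add: length_nths_subset)
      have "\<omega> (h L) (card L + card (M L)) (map (\<lambda>k. (c k, z k)) (nths ks L) @ nths ws (M L))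
        = \<omega> (h L) (card L + card (M L)) (map (\<lambda>k. (d k, z k)) (nths ks L) @ nths ws (M L))
          * prod_list (map ?cd (nths ks L))"
      proof (rule mero_ndiff_change_coords[OF A])
        show "mero_ndiff A (length (nths ks L) + length (nths ws (M L))) (\<omega> (h L) (card L + card (M L)))"
          using \<omega>[OF n, of "h L"] len by simp
        show "(c k, z k) \<in> fpoints A" "(d k, z k) \<in> fpoints A" if "k \<in> set (nths ks L)" for k
          using cz dz in_set_nthsD[OF that] by blast+
        show "set (nths ws (M L)) \<subseteq> fpoints A"
          using ws set_nths_subset[of ws "M L"] by blast
      qed
      then show ?thesis
        by (simp only: nths_map prod_list_map_nths[OF L(1)])
    qed
    then have "(\<Prod>L\<in>P. \<omega> (h L) (card L + card (M L)) (nths (map (\<lambda>k. (c k, z k)) ks) L @ nths ws (M L)))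
      = (\<Prod>L\<in>P. \<omega> (h L) (card L + card (M L)) (nths (map (\<lambda>k. (d k, z k)) ks) L @ nths ws (M L)))
         * (\<Prod>L\<in>P. \<Prod>i\<in>L. ?cd (ks ! i))"
      by (simp add: prod.distrib)
    also have "(\<Prod>L\<in>P. \<Prod>i\<in>L. ?cd (ks ! i)) = (\<Prod>i<length ks. ?cd (ks ! i))"
      by (rule prod.partition[symmetric]) (use P in auto)
    also have "\<dots> = prod_list (map ?cd ks)"
      by (subst prod.list_conv_set_nth) (auto simp: atLeast0LessThan)
    finally show ?thesis .
  qed
  then show ?thesis
    unfolding Wprime_def Let_def sum_distrib_right
    by (intro sum.cong refl) auto
qed

text \<open>\<open>Wprime\<close> omits the factors \<open>\<omega> 0 1\<close>. A remaining factor
  is either stable, and then regular off \<open>Ram S\<close>, or it is \<open>\<omega> 0 2\<close>,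
  which is regular off the diagonal.\<close>

lemma Wprime_analytic:
  assumes A: "A = atlas S" and \<omega>: "correlators S \<omega>" and S: "spectral_curve S"
    and Z: "\<And>r. r \<in> set qs \<Longrightarrow> Z r \<in> local_coords A \<and> r \<in> fst (Z r) \<and> snd (Z r) r = 0"
    and qs: "distinct qs" "set qs \<inter> Ram S = {}"
    and ws: "set ws \<subseteq> fpoints A" "snd ` set ws \<inter> (set qs \<union> Ram S) = {}"
  shows "(\<lambda>u. Wprime \<omega> g (map (\<lambda>r. (Z r, coord_inv (Z r) u)) qs) ws) analytic_on {0}"
proof -
  have factor: "(\<lambda>u. \<omega> h (length rs + length vs) (map (\<lambda>r. (Z r, coord_inv (Z r) u)) rs @ vs)) analytic_on {0}"
    if rs: "distinct rs" "set rs \<subseteq> set qs" "rs \<noteq> []" and vs: "set vs \<subseteq> set ws"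
      and h: "\<not> (h = 0 \<and> length rs + length vs = 1)" for h rs vs
  proof -
    define n where "n = length rs + length vs"
    define fs where "fs = map (\<lambda>r. (Z r, r)) rs @ vs"
    have n: "n \<ge> 1" "length fs = n"
      using rs(3) by (auto simp: n_def fs_def Suc_le_eq)
    have fs: "set fs \<subseteq> fpoints A" "snd ` set fs \<inter> Ram S = {}"
    proof -
      show "set fs \<subseteq> fpoints A"
        using rs(2) vs Z ws(1) by (auto simp: fs_def fpoints_def)
      have "snd ` set fs \<subseteq> set qs \<union> snd ` set ws"
        using rs(2) vs by (auto simp: fs_def)
      then show "snd ` set fs \<inter> Ram S = {}"
        using qs ws(2) by blast
    qed
    have reg: "ndiff_regular_at (\<omega> h n) fs"
    proof (cases "2 * int h - 2 + int n > 0")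
      case True
      then show ?thesis using \<omega> fs n A unfolding correlators_def by blast
    next
      case False
      then have hn: "h = 0" "n = 2" using h n by (auto simp: n_def)
      then obtain a b where ab: "fs = [a, b]"
        using n that by (auto simp: length_Suc_conv numeral_2_eq_2)
      have "snd a \<noteq> snd b"
      \<comment> \<open>A block is never empty, so at least one of the two points lies on a sheet.
        Two entries of \<open>ws\<close>, which may coincide, therefore never meet in one
        factor.\<close>
      proof (cases "length rs = 1")
        case True
        then obtain r where "rs = [r]" by (auto simp: length_Suc_conv)
        then have "snd a \<in> set qs" "b \<in> set ws"
          using ab rs vs by (auto simp: fs_def)
        then show ?thesis using ws by auto
      next
        case False
        then have "vs = []" using rs(3) hn by (cases rs; cases vs) (auto simp: n_def)
        then have "map snd fs = rs" by (simp add: fs_def o_def)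
        then show ?thesis using ab rs(1) by auto
      qed
      then show ?thesis
        using S \<omega> fs ab A unfolding spectral_curve_def correlators_def hn by auto
    qed
    let ?cs = "map Z rs @ map fst vs"
    \<comment> \<open>The diagonal in the sheet variables: all sheets carry the same parameter u,
      and the w-variables are frozen.\<close>
    let ?\<gamma> = "\<lambda>u. replicate (length rs) u @ map (\<lambda>(c, z). snd c z) vs"
    have "map fst fs = ?cs" "coord_values fs = ?\<gamma> 0"
      using Z rs(2) by (auto simp: fs_def coord_values_def o_def map_replicate_const[symmetric])
    then have "holo_near (local_expr (\<omega> h n) ?cs) (?\<gamma> 0)"
      using reg by (simp add: ndiff_regular_at_def)
    then have "(\<lambda>u. local_expr (\<omega> h n) ?cs (?\<gamma> u)) analytic_on {0}"
      by (rule analytic_along_affine_curve[where n = n and k = "\<lambda>i. if i < length rs then 1 else 0"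
            and b = "\<lambda>i. if i < length rs then 0 else ?\<gamma> 0 ! i"])
        (auto simp: n_def nth_append)
    moreover have "local_expr (\<omega> h n) ?cs (?\<gamma> u) = \<omega> h n (map (\<lambda>r. (Z r, coord_inv (Z r) u)) rs @ vs)" for u
    proof -
      have "coord_inv (fst f) (snd (fst f) (snd f)) = snd f" if "f \<in> set vs" for f
        using that vs ws(1) local_coordsD(3)[of "fst f" A "snd f"] by (auto simp: fpoints_def)
      then have "map2 (\<lambda>c t. (c, coord_inv c t)) (map fst vs) (map (\<lambda>(c, z). snd c z) vs) = vs"
        by (intro nth_equalityI) (auto simp: case_prod_beta prod_eq_iff)
      moreover have "map2 (\<lambda>c t. (c, coord_inv c t)) (map Z rs) (replicate (length rs) u)
          = map (\<lambda>r. (Z r, coord_inv (Z r) u)) rs"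
        by (rule nth_equalityI) auto
      ultimately show ?thesis by (simp add: local_expr_def)
    qed
    ultimately show ?thesis by (simp add: n_def)
  qed
  show ?thesis
    unfolding Wprime_def Let_def length_map
  proof (intro analytic_on_sum, goal_cases)
    case (1 P M h)
    then have P: "partition_on {..<length qs} P" and M: "M \<in> P \<rightarrow>\<^sub>E Pow {..<length ws}" by auto
    show ?case
    proof (cases "\<exists>L\<in>P. h L = 0 \<and> card L + card (M L) = 1")
      case False
      have "(\<lambda>u. \<omega> (h L) (card L + card (M L))
         (nths (map (\<lambda>r. (Z r, coord_inv (Z r) u)) qs) L @ nths ws (M L))) analytic_on {0}" if "L \<in> P" for L
      proof -
        have L: "L \<subseteq> {..<length qs}" "L \<noteq> {}" and MI: "M L \<subseteq> {..<length ws}"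
          using that partition_onD1[OF P] partition_onD3[OF P] PiE_mem[OF M that] by blast+
        have len: "length (nths qs L) = card L" "length (nths ws (M L)) = card (M L)"
          using L MI by (simp_all add: length_nths_subset)
        have "finite L" using L finite_subset by blast
        then have "nths qs L \<noteq> []" using L len by auto
        moreover have "\<not> (h L = 0 \<and> card L + card (M L) = 1)"
          using that False by blast
        ultimately show ?thesis
          using factor[of "nths qs L" "nths ws (M L)" "h L", unfolded len] qs(1)
            set_nths_subset[of qs L] set_nths_subset[of ws "M L"]
          by (simp add: nths_map)
      qed
      then show ?thesis
        unfolding if_not_P[OF False] by (rule analytic_on_prod)
    qed simp
  qed
qed

section \<open>The form \<open>\<omega>\<^sub>0\<^sub>,\<^sub>1\<close>\<close>

lemma spectral_curveD:
  assumes "spectral_curve S"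
  shows "complex_atlas (atlas S)" "mero_ndiff (atlas S) 1 (om01 S)"
    "C \<in> components UNIV \<Longrightarrow> \<exists>f\<in>fpoints (atlas S). snd f \<in> C \<and> om01 S [f] \<noteq> 0"
  using assms unfolding spectral_curve_def finite_union_of_riemann_surfaces_def by blast+

lemma om01_change_coord:
  assumes S: "spectral_curve S" and "(c, z) \<in> fpoints (atlas S)" "(d, z) \<in> fpoints (atlas S)"
  shows "om01 S [(c, z)] = om01 S [(d, z)] * coord_deriv c d z"
  using mero_ndiff_change_coords[OF spectral_curveD(1)[OF S], where ks = "[()]" and ws = "[]"
      and c = "\<lambda>_. c" and d = "\<lambda>_. d" and z = "\<lambda>_. z" and \<omega> = "om01 S"]
    spectral_curveD(2)[OF S] assms(2,3) by simp

lemma om01_eq_0_iff: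
  assumes S: "spectral_curve S" and "(c, z) \<in> fpoints (atlas S)" "(d, z) \<in> fpoints (atlas S)"
  shows "om01 S [(c, z)] = 0 \<longleftrightarrow> om01 S [(d, z)] = 0"
  using om01_change_coord[OF assms] coord_deriv_nonzero[OF spectral_curveD(1)[OF S], of c d z] assms(2,3)
  by (auto simp: fpoints_def)

lemma om01_mero_near:
  assumes S: "spectral_curve S" and c: "(c, p) \<in> fpoints (atlas S)"
  shows "mero_near (local_expr (om01 S) [c]) [snd c p]"
proof -
  have "set [(c, p)] \<subseteq> fpoints (atlas S) \<and> length [(c, p)] = 1"
    using c by simp
  then have "mero_near (local_expr (om01 S) (map fst [(c, p)])) (coord_values [(c, p)])"
    using spectral_curveD(2)[OF S] unfolding mero_ndiff_def by blast
  then show ?thesis by (simp add: coord_values_def)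
qed

lemma om01_meromorphic:
  assumes S: "spectral_curve S" and c: "(c, p) \<in> fpoints (atlas S)"
  shows "(\<lambda>t. om01 S [(c, coord_inv c t)]) meromorphic_on {snd c p}"
  using mero_near_one_variable(1)[OF om01_mero_near[OF assms]] by (simp add: local_expr_def)

text \<open>
  The points near which \<open>\<omega>\<^sub>0\<^sub>,\<^sub>1\<close> vanishes form an open and closed set, which by the
  assumption on \<open>\<omega>\<^sub>0\<^sub>,\<^sub>1\<close> contains no component.
\<close>

lemma om01_not_locally_zero:
  assumes S: "spectral_curve S" and c: "(c, p) \<in> fpoints (atlas S)"
  shows "\<forall>\<^sub>F t in at (snd c p). om01 S [(c, coord_inv c t)] \<noteq> 0"
proof -
  note A = spectral_curveD(1)[OF S]
  \<comment> \<open>The values of \<open>h\<close> depend on unrelated charts at different points,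
    but its zeros do not, because the Jacobians do not vanish.\<close>
  define h where "h = (\<lambda>z. om01 S [(coord_at (atlas S) z, z)])"
  have fp: "(coord_at (atlas S) z, z) \<in> fpoints (atlas S)" for z
    using coord_at_in[OF A] by (simp add: fpoints_def)
  have h0: "h z = 0 \<longleftrightarrow> om01 S [(d, z)] = 0" if "(d, z) \<in> fpoints (atlas S)" for d z
    unfolding h_def by (rule om01_eq_0_iff[OF S fp that])
  define N where "N = {z. \<exists>W. open W \<and> z \<in> W \<and> (\<forall>w\<in>W. h w = 0)}"
  have dich: "z \<in> N \<or> (\<exists>\<rho>>0. \<forall>t\<in>ball (snd d z) \<rho> - {snd d z}. om01 S [(d, coord_inv d t)] \<noteq> 0)"
    if d: "(d, z) \<in> fpoints (atlas S)" for d z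
  proof -
    have dl: "d \<in> local_coords (atlas S)" "z \<in> fst d" using d by (auto simp: fpoints_def)
    have "z \<in> N" if \<rho>: "\<rho> > 0" "\<forall>t\<in>ball (snd d z) \<rho>. om01 S [(d, coord_inv d t)] = 0" for \<rho>
    proof -
      have "open (fst d \<inter> snd d -` ball (snd d z) \<rho>)"
        using continuous_on_coord[OF A dl(1)] local_coordsD(1)[OF dl(1)]
        by (intro continuous_open_preimage) auto
      moreover have "h w = 0" if w: "w \<in> fst d \<inter> snd d -` ball (snd d z) \<rho>" for w
      proof -
        have "(d, w) \<in> fpoints (atlas S)" using w dl(1) by (simp add: fpoints_def)
        moreover have "om01 S [(d, coord_inv d (snd d w))] = 0" using w \<rho>(2) by blast
        ultimately show ?thesis using h0 local_coordsD(3)[OF dl(1)] w by simp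
      qed
      ultimately show ?thesis
        unfolding N_def using dl(2) \<rho>(1)
        by (intro CollectI exI[of _ "fst d \<inter> snd d -` ball (snd d z) \<rho>"]) auto
    qed
    then show ?thesis
      using mero_near_one_variable(2)[OF om01_mero_near[OF S d]] by (auto simp: local_expr_def)
  qed
  have "open N"
    unfolding open_subopen[of N] by (auto simp: N_def)
  moreover have "open (- N)"
    unfolding open_subopen[of "- N"]
  proof
    fix z assume "z \<in> - N"
    define d where "d = coord_at (atlas S) z"
    have d: "(d, z) \<in> fpoints (atlas S)" and dl: "d \<in> local_coords (atlas S)" "z \<in> fst d"
      using fp coord_at_in[OF A] by (auto simp: d_def)
    obtain \<rho> where \<rho>: "\<rho> > 0" "\<forall>t\<in>ball (snd d z) \<rho> - {snd d z}. om01 S [(d, coord_inv d t)] \<noteq> 0"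
      using dich[OF d] \<open>z \<in> - N\<close> by blast
    let ?W = "fst d \<inter> snd d -` ball (snd d z) \<rho>"
    have "open ?W"
      using continuous_on_coord[OF A dl(1)] local_coordsD(1)[OF dl(1)]
      by (intro continuous_open_preimage) auto
    moreover have "w \<in> - N" if w: "w \<in> ?W" for w
    proof (cases "w = z")
      case False
      then have "snd d w \<noteq> snd d z"
        using w dl(2) local_coordsD(2)[OF dl(1)] by (auto simp: inj_on_def)
      then have "om01 S [(d, coord_inv d (snd d w))] \<noteq> 0"
        using \<rho>(2) w by auto
      then have "h w \<noteq> 0"
        using h0[of d w] local_coordsD(3)[OF dl(1)] w dl(1) by (simp add: fpoints_def)
      then show ?thesis by (auto simp: N_def)
    qed (use \<open>z \<in> - N\<close> in simp)
    ultimately show "\<exists>T. open T \<and> z \<in> T \<and> T \<subseteq> - N"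
      using \<rho>(1) dl(2) by (intro exI[of _ ?W]) auto
  qed
  ultimately have clopen: "C \<subseteq> N \<or> C \<inter> N = {}" if "connected C" for C
    using connectedD[OF that, of N "- N"] by blast
  have "p \<notin> N"
  proof
    assume "p \<in> N"
    define C where "C = connected_component_set UNIV p"
    have "C \<in> components UNIV" "connected C" "p \<in> C"
      by (auto simp: C_def components_def connected_component_refl)
    then obtain f where f: "f \<in> fpoints (atlas S)" "snd f \<in> N" "om01 S [f] \<noteq> 0"
      using spectral_curveD(3)[OF S, of C] clopen[of C] \<open>p \<in> N\<close> by blast
    then have "h (snd f) = 0" by (auto simp: N_def)
    then show False using h0[of "fst f" "snd f"] f by simp
  qed
  then show ?thesis
    using dich[OF c] by (auto simp: eventually_at dist_commute)
qed

section \<open>Standard coordinates at unramified points and the expansion of \<open>om01\<close> in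
  them\<close>

definition sphere_chart :: "sphere \<Rightarrow> complex \<Rightarrow> sphere" where
  "sphere_chart q u = (case q of Fin a \<Rightarrow> Fin (a + u) | Infty \<Rightarrow> sphere_inv (Fin u))"

text \<open>\<open>centred_coord q\<close> is a left inverse of
  \<open>sphere_chart q\<close>.\<close>

lemma inj_sphere_chart: "inj (sphere_chart q)"
  by (cases q) (auto simp: sphere_chart_def inj_def split: if_splits)

lemma sphere_chart_derivative:
  assumes "u \<noteq> 0"
  shows "(fin_part \<circ> sphere_chart q) field_differentiable at u"
    and "deriv (fin_part \<circ> sphere_chart q) u \<noteq> 0"
proof -
  have "\<exists>D. D \<noteq> 0 \<and> ((fin_part \<circ> sphere_chart q) has_field_derivative D) (at u)"
  proof (cases q)
    case (Fin a)
    have "((\<lambda>s. a + s) has_field_derivative 1) (at u)"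
      by (auto intro!: derivative_eq_intros)
    then show ?thesis
      by (intro exI[of _ 1]) (simp add: Fin sphere_chart_def o_def)
  next
    case Infty
    \<comment> \<open>This holds at 0 too, where \<open>fin_part Infty\<close> and
      \<open>inverse 0\<close> are both 0 by convention; the derivative exists only away from
      0.\<close>
    then have "fin_part \<circ> sphere_chart q = inverse"
      by (auto simp: sphere_chart_def)
    then show ?thesis
      using DERIV_inverse[OF assms] assms by (intro exI[of _ "- (inverse u ^ Suc (Suc 0))"]) auto
  qed
  then show "(fin_part \<circ> sphere_chart q) field_differentiable at u"
    and "deriv (fin_part \<circ> sphere_chart q) u \<noteq> 0"
    by (auto simp: field_differentiable_def DERIV_imp_deriv)
qed

lemma xmap_standard_coord:
  assumes "standard_coord S p c" "ram_order S p = 1" "z \<in> fst c"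
  shows "xmap S z = sphere_chart (xmap S p) (snd c z)"
proof -
  have "xmap S z = (case xmap S p of Fin a \<Rightarrow> Fin (a + snd c z ^ ram_order S p)
         | Infty \<Rightarrow> sphere_inv (Fin (snd c z ^ ram_order S p)))"
    using assms unfolding standard_coord_def by blast
  then show ?thesis
    by (simp only: assms(2) power_one_right sphere_chart_def)
qed

lemma standard_coord_unique:
  assumes c: "standard_coord S p c" and d: "standard_coord S p d" and r: "ram_order S p = 1"
    and z: "z \<in> fst c" "z \<in> fst d"
  shows "snd c z = snd d z"
  using xmap_standard_coord[OF c r z(1)] xmap_standard_coord[OF d r z(2)] inj_sphere_chart
  by (simp add: inj_eq)

lemma standard_coordD:
  assumes "standard_coord S p c"
  shows "c \<in> local_coords (atlas S)" "p \<in> fst c" "snd c p = 0" "(c, p) \<in> fpoints (atlas S)"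
  using assms by (auto simp: standard_coord_def fpoints_def)

text \<open>\<open>tau_coeff\<close> uses a standard coordinate picked by \<open>SOME\<close>. For
  ramification order 1 two such coordinates have equal values on their common domain. Their domains
  may differ, so the expressions of \<open>om01\<close> agree only near 0, which is enough for the
  Laurent coefficients.\<close>

lemma om01_standard_coord_unique:
  assumes S: "spectral_curve S"
    and c: "standard_coord S p c" and d: "standard_coord S p d" and r: "ram_order S p = 1"
  shows "\<forall>\<^sub>F t in nhds 0. om01 S [(c, coord_inv c t)] = om01 S [(d, coord_inv d t)]"
proof -
  note A = spectral_curveD(1)[OF S]
  note cD = standard_coordD[OF c] and dD = standard_coordD[OF d]
  have ev: "\<forall>\<^sub>F t in nhds (snd c z). coord_inv c t \<in> fst d \<inter> fst c \<and> snd c (coord_inv c t) = t"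
    if "z \<in> fst c" "z \<in> fst d" for z
    using that by (intro eventually_coord_inv[OF A cD(1) local_coordsD(1)[OF dD(1)]])
  have "\<forall>\<^sub>F t in nhds 0. coord_inv c t \<in> fst d \<inter> fst c \<and> snd c (coord_inv c t) = t"
    using ev[of p] cD dD by simp
  then show ?thesis
  proof eventually_elim
    case (elim t)
    define z where "z = coord_inv c t"
    have z: "z \<in> fst c" "z \<in> fst d" "snd c z = t" "snd d z = t"
      using elim standard_coord_unique[OF c d r, of z] by (auto simp: z_def)
    have "\<forall>\<^sub>F t in nhds (snd c z). (snd d \<circ> coord_inv c) t = t"
      using ev[OF z(1,2)] by eventually_elim (use standard_coord_unique[OF c d r] in auto)
    then have "coord_deriv c d z = 1"
      unfolding coord_deriv_def by (subst deriv_cong_ev[where g = "\<lambda>t. t"]) auto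
    moreover have "coord_inv d t = z"
      using local_coordsD(3)[OF dD(1) z(2)] z by simp
    ultimately show ?case
      using om01_change_coord[OF S, of c z d] z cD dD by (simp add: fpoints_def z_def)
  qed
qed

text \<open>The shift by 1 comes from writing the form as a series in \<zeta> times
  d\<zeta>/\<zeta>. Since \<open>om01\<close> is not locally zero, F is nonzero, and the
  \<open>LEAST\<close> over the integers in \<open>sbar\<close> is attained at its lowest
  exponent.\<close>

lemma om01_laurent_expansion:
  assumes S: "spectral_curve S" and c: "standard_coord S p c" and r: "ram_order S p = 1"
  obtains F where "(\<lambda>t. om01 S [(c, coord_inv c t)]) has_laurent_expansion F"
    "F \<noteq> 0" "fls_subdegree F = sbar S p - 1" "fls_nth F (sbar S p - 1) = tau S p"
proof
  let ?f = "\<lambda>c t. om01 S [(c, coord_inv c t)]"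
  define F where "F = laurent_expansion (?f c) 0"
  have "?f c meromorphic_on {0}"
    using om01_meromorphic[OF S standard_coordD(4)[OF c]] standard_coordD(3)[OF c] by simp
  then show F: "?f c has_laurent_expansion F"
    unfolding F_def meromorphic_at_iff using not_essential_has_laurent_expansion_0 by blast
  have "\<forall>\<^sub>F t in at 0. ?f c t \<noteq> 0"
    using om01_not_locally_zero[OF S standard_coordD(4)[OF c]] standard_coordD(3)[OF c] by simp
  then show "F \<noteq> 0"
    using has_laurent_expansion_eventually_nonzero_iff[of "?f c" 0 F] F by simp
  define d where "d = (SOME c. standard_coord S p c)"
  have "standard_coord S p d"
    unfolding d_def using c by (rule someI)
  then have "\<forall>\<^sub>F t in nhds 0. ?f d t = ?f c t"
    by (rule om01_standard_coord_unique[OF S _ c r])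
  then have "laurent_expansion (?f d) 0 = F"
    unfolding F_def by (intro laurent_expansion_cong) (auto simp: eventually_at_filter elim: eventually_mono)
  then have tau: "tau_coeff S p l = fls_nth F (l - 1)" for l
    by (simp add: tau_coeff_def d_def Let_def)
  have "sbar S p = fls_subdegree F + 1"
    unfolding sbar_def tau
  proof (rule Least_equality)
    show "fls_nth F (fls_subdegree F + 1 - 1) \<noteq> 0"
      using \<open>F \<noteq> 0\<close> by simp
    show "fls_subdegree F + 1 \<le> l" if "fls_nth F (l - 1) \<noteq> 0" for l
      using fls_subdegree_leI[OF that] by simp
  qed
  then show "fls_subdegree F = sbar S p - 1" by simp
  show "fls_nth F (sbar S p - 1) = tau S p"
    by (simp add: tau_def tau)
qed

text \<open>The value of f at 0 may be an artefact, for instance of division by zero. The sum of the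
  series repairs it and agrees with f wherever a residue at 0 looks.\<close>

lemma has_laurent_expansion_analytic_extension:
  assumes F: "f has_laurent_expansion F" and "fls_subdegree F \<ge> 0"
  obtains e where "e analytic_on {0}" "\<forall>\<^sub>F u in at 0. e u = f u"
proof
  show "eval_fls F analytic_on {0}"
    using assms by (intro analytic_on_eval_fls) (auto simp: has_laurent_expansion_def zero_ereal_def)
  show "\<forall>\<^sub>F u in at 0. eval_fls F u = f u"
    using F by (simp add: has_laurent_expansion_def)
qed

lemma inverse_diff_om01_analytic:
  assumes S: "spectral_curve S"
    and c: "standard_coord S p c" "ram_order S p = 1" and d: "standard_coord S r d" "ram_order S r = 1"
    and sbar: "\<not> (sbar S p \<ge> 2 \<and> sbar S r \<ge> 2)"
    and tau: "sbar S p = sbar S r \<Longrightarrow> tau S p \<noteq> tau S r"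
  obtains e where "e analytic_on {0}"
    "\<forall>\<^sub>F u in at 0. e u = 1 / (om01 S [(d, coord_inv d u)] - om01 S [(c, coord_inv c u)])"
proof -
  obtain F where F: "(\<lambda>t. om01 S [(c, coord_inv c t)]) has_laurent_expansion F"
    "F \<noteq> 0" "fls_subdegree F = sbar S p - 1" "fls_nth F (sbar S p - 1) = tau S p"
    using om01_laurent_expansion[OF S c] .
  obtain G where G: "(\<lambda>t. om01 S [(d, coord_inv d t)]) has_laurent_expansion G"
    "G \<noteq> 0" "fls_subdegree G = sbar S r - 1" "fls_nth G (sbar S r - 1) = tau S r"
    using om01_laurent_expansion[OF S d] .
  define n where "n = min (fls_subdegree F) (fls_subdegree G)"
  \<comment> \<open>If the lowest exponents differ, only one of the two series has a term at n; if
    they agree, the coefficient is the difference of the two \<open>tau\<close>.\<close>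
  have nz: "fls_nth (G - F) n \<noteq> 0"
  proof (cases "fls_subdegree F" "fls_subdegree G" rule: linorder_cases)
    case less
    then show ?thesis using F(2) by (simp add: n_def)
  next
    case equal
    then show ?thesis using tau F G by (simp add: n_def)
  next
    case greater
    then show ?thesis using G(2) by (simp add: n_def)
  qed
  \<comment> \<open>One of the two \<open>sbar\<close> is at most 1, and the series start at
    \<open>sbar - 1\<close>.\<close>
  moreover have "n \<le> 0" using sbar F(3) G(3) by (auto simp: n_def)
  ultimately have "fls_subdegree (inverse (G - F)) \<ge> 0"
    using fls_subdegree_leI[OF nz] by auto
  moreover have "(\<lambda>u. 1 / (om01 S [(d, coord_inv d u)] - om01 S [(c, coord_inv c u)]))
      has_laurent_expansion inverse (G - F)"
    unfolding inverse_eq_divide[symmetric]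
    by (intro has_laurent_expansion_inverse has_laurent_expansion_diff F G)
  ultimately show thesis
    using has_laurent_expansion_analytic_extension that by blast
qed

section \<open>Unramified fibres\<close>

text \<open>\<open>fibre_nbhds\<close> provides some standard coordinate on each \<open>U p\<close>.
  Fixing one as \<open>Z p\<close> for every p lets a single parameter u name a point on each
  sheet.\<close>

locale unramified_fibre =
  fixes S :: "'a::t2_space spectral_data" and q :: sphere and P :: "'a set"
    and V :: "sphere set" and U :: "'a \<Rightarrow> 'a set" and Z :: "'a \<Rightarrow> 'a coord"
  assumes spectral_curve: "spectral_curve S"
    and fibre: "P = xmap S -` {q}" and finite_fibre: "finite P"
    and nbhds: "fibre_nbhds S q V U"
    and unramified: "p \<in> P \<Longrightarrow> ram_order S p = 1"
    and standard: "p \<in> P \<Longrightarrow> standard_coord S p (Z p)" "p \<in> P \<Longrightarrow> fst (Z p) = U p"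
begin

lemma atlas: "complex_atlas (atlas S)"
  by (rule spectral_curveD(1)[OF spectral_curve])

lemma Z_local: "p \<in> P \<Longrightarrow> Z p \<in> local_coords (atlas S)"
  and Z_centred: "p \<in> P \<Longrightarrow> snd (Z p) p = 0"
  and in_U: "p \<in> P \<Longrightarrow> p \<in> U p"
  and Z_inv: "p \<in> P \<Longrightarrow> z \<in> U p \<Longrightarrow> coord_inv (Z p) (snd (Z p) z) = z"
  and open_U: "p \<in> P \<Longrightarrow> open (U p)"
  using standard_coordD[OF standard(1)] standard(2) local_coordsD by metis+

lemma U_disjoint: "r \<in> P \<Longrightarrow> s \<in> P \<Longrightarrow> z \<in> U r \<Longrightarrow> z \<in> U s \<Longrightarrow> r = s"
  using nbhds fibre unfolding fibre_nbhds_def disjoint_family_on_def by blast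

lemma xmap_U: "r \<in> P \<Longrightarrow> z \<in> U r \<Longrightarrow> xmap S z = sphere_chart q (snd (Z r) z)"
  using xmap_standard_coord[OF standard(1) unramified] standard(2) fibre by auto

text \<open>The point of the sheet through \<open>r\<close> at which \<open>x - q\<close> (or \<open>1 / x\<close>) equals \<open>u\<close>.\<close>

definition sheet :: "complex \<Rightarrow> 'a \<Rightarrow> 'a" where
  "sheet u r = coord_inv (Z r) u"

definition evenly_covered :: "complex \<Rightarrow> bool" where
  "evenly_covered u \<longleftrightarrow> (\<forall>r\<in>P. u \<in> snd (Z r) ` U r)"

lemma sheet:
  assumes "evenly_covered u" "r \<in> P"
  shows "sheet u r \<in> U r" "snd (Z r) (sheet u r) = u"
  using assms Z_inv unfolding evenly_covered_def sheet_def by auto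

lemma eventually_evenly_covered: "\<forall>\<^sub>F u in nhds 0. evenly_covered u"
  unfolding evenly_covered_def
proof (intro eventually_ball_finite finite_fibre ballI)
  fix r assume r: "r \<in> P"
  have "open (snd (Z r) ` U r)"
    using Z_local[OF r] open_U[OF r] standard(2)[OF r] by (intro open_coord_image[OF atlas]) auto
  moreover have "0 \<in> snd (Z r) ` U r"
    using Z_centred[OF r] in_U[OF r] by force
  ultimately show "\<forall>\<^sub>F u in nhds 0. u \<in> snd (Z r) ` U r"
    by (rule eventually_nhds_in_open)
qed

lemma inj_on_sheet: "evenly_covered u \<Longrightarrow> inj_on (sheet u) P"
  by (rule inj_onI) (metis sheet(1) U_disjoint)

text \<open>The value of x determines u, because \<open>sphere_chart q\<close> is injective, so the
  only point of \<open>U r\<close> with the same x is \<open>sheet u r\<close>.\<close>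

lemma fprime_sheet:
  assumes u: "evenly_covered u" and p: "p \<in> P" and Q: "Q \<subseteq> P"
  shows "fprime S U Q (sheet u p) = sheet u ` (Q - {p})"
proof -
  have "z = sheet u r" if "r \<in> Q" "z \<in> U r" "xmap S z = xmap S (sheet u p)" for z r
  proof -
    have "sphere_chart q (snd (Z r) z) = sphere_chart q u"
      using that xmap_U[of r z] xmap_U[of p "sheet u p"] sheet[OF u p] p Q by auto
    then show ?thesis
      using inj_sphere_chart Z_inv[of r z] that Q by (auto simp: sheet_def inj_eq)
  qed
  note 1 = this
  have 2: "sheet u r \<in> U r" "xmap S (sheet u r) = xmap S (sheet u p)" "sheet u r = sheet u p \<Longrightarrow> r = p"
    if "r \<in> Q" for r
    using that Q p sheet[OF u] xmap_U inj_on_sheet[OF u] by (auto simp: inj_on_def subset_iff)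
  show ?thesis
  proof (intro set_eqI iffI)
    fix z assume "z \<in> fprime S U Q (sheet u p)"
    then obtain r where "r \<in> Q" "z \<in> U r" "xmap S z = xmap S (sheet u p)" "z \<noteq> sheet u p"
      by (auto simp: fprime_def)
    then show "z \<in> sheet u ` (Q - {p})"
      using 1[of r z] by blast
  next
    fix z assume "z \<in> sheet u ` (Q - {p})"
    then obtain r where "r \<in> Q" "r \<noteq> p" "z = sheet u r" by blast
    then show "z \<in> fprime S U Q (sheet u p)"
      using 2[of r] by (auto simp: fprime_def)
  qed
qed

text \<open>In the coordinate \<open>Z r\<close> the map x is \<open>sphere_chart q\<close>,
  whatever r is. The first factor thus depends on u alone, which is why it cancels between
  sheets.\<close>

lemma dx_eq:
  assumes r: "r \<in> P" and z: "z \<in> U r" "snd (Z r) z \<noteq> 0" and d: "(d, z) \<in> fpoints (atlas S)"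
  shows "dx S (d, z) = deriv (fin_part \<circ> sphere_chart q) (snd (Z r) z) * coord_deriv d (Z r) z"
proof -
  let ?u = "snd (Z r) z"
  have ev: "\<forall>\<^sub>F s in nhds ?u. (fin_part \<circ> xmap S \<circ> coord_inv (Z r)) s = (fin_part \<circ> sphere_chart q) s"
    using eventually_coord_inv[OF atlas Z_local[OF r] open_U[OF r], of z] z standard(2)[OF r]
    by (auto elim!: eventually_mono simp: xmap_U[OF r])
  obtain D where "((fin_part \<circ> sphere_chart q) has_field_derivative D) (at ?u)"
    using sphere_chart_derivative(1)[OF z(2)] by (auto simp: field_differentiable_def)
  then have "((fin_part \<circ> xmap S \<circ> coord_inv (Z r)) has_field_derivative D) (at ?u)"
    using DERIV_cong_ev[OF refl ev refl] by blast
  then have "(fin_part \<circ> xmap S \<circ> coord_inv (Z r)) field_differentiable at ?u"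
    by (auto simp: field_differentiable_def)
  then have "deriv (fin_part \<circ> xmap S \<circ> coord_inv d) (snd d z)
      = deriv (fin_part \<circ> xmap S \<circ> coord_inv (Z r)) ?u * coord_deriv d (Z r) z"
    using d z standard(2)[OF r] by (intro deriv_change_coord[OF atlas _ Z_local[OF r]]) (auto simp: fpoints_def)
  also have "deriv (fin_part \<circ> xmap S \<circ> coord_inv (Z r)) ?u = deriv (fin_part \<circ> sphere_chart q) ?u"
    by (rule deriv_cong_ev[OF ev refl])
  finally show ?thesis unfolding dx_def prod.case .
qed

lemma framed: "(coord_at (atlas S) z, z) \<in> fpoints (atlas S)"
  using coord_at_in[OF atlas] by (simp add: fpoints_def)

lemma framed_Z: "r \<in> P \<Longrightarrow> z \<in> U r \<Longrightarrow> (Z r, z) \<in> fpoints (atlas S)"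
  using Z_local standard(2) by (simp add: fpoints_def)

lemma coord_deriv_Z_nonzero:
  "r \<in> P \<Longrightarrow> z \<in> U r \<Longrightarrow> (d, z) \<in> fpoints (atlas S) \<Longrightarrow> coord_deriv d (Z r) z \<noteq> 0"
  using framed_Z[of r z] by (intro coord_deriv_nonzero[OF atlas]) (auto simp: fpoints_def)

text \<open>The chart picked inside \<open>yfun\<close> contributes the same Jacobian to
  \<open>om01\<close> and to \<open>dx\<close>.\<close>

lemma yfun_eq:
  assumes r: "r \<in> P" and z: "z \<in> U r" "snd (Z r) z \<noteq> 0"
  shows "yfun S z = om01 S [(Z r, z)] / deriv (fin_part \<circ> sphere_chart q) (snd (Z r) z)"
  using coord_deriv_Z_nonzero[OF r z(1) framed]
  by (simp add: yfun_def Let_def dx_eq[OF r z framed] om01_change_coord[OF spectral_curve framed framed_Z[OF r z(1)]])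

section \<open>The summands of the recursion in the common coordinate, and the residue of the local
  sum\<close>

definition om01_sheet :: "'a \<Rightarrow> complex \<Rightarrow> complex" where
  "om01_sheet r u = om01 S [(Z r, coord_inv (Z r) u)]"

text \<open>A count of Jacobians, with J, \<open>cd\<close> and D as defined in the proof. Each
  kernel denominator is (difference of \<open>om01_sheet\<close>) / D times D J. Reframing
  \<open>Wprime\<close> in the coordinates \<open>Z\<close> gives J times the product of the
  \<open>cd r\<close>, and the pullback gives D J / (D \<open>cd r\<close>) for each r. All D and
  \<open>cd r\<close> cancel, and one J is left, as befits a 1-form in z.\<close>

lemma summand_eq:
  assumes \<omega>: "correlators S \<omega>" and u: "evenly_covered u" "u \<noteq> 0"
    and p: "p \<in> P" and c: "(c, sheet u p) \<in> fpoints (atlas S)"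
    and rs: "distinct rs" "set rs \<subseteq> P - {p}" and ws: "set ws \<subseteq> fpoints (atlas S)"
  shows "Kernel S \<alpha> w0 (c, sheet u p) (sheet u ` set rs)
       * Wprime_pullback S \<omega> g (c, sheet u p) (sheet u ` set rs) ws
    = - \<alpha> w0 (sheet u p) * Wprime \<omega> g (map (\<lambda>r. (Z r, coord_inv (Z r) u)) (p # rs)) ws
       * coord_deriv c (Z p) (sheet u p) * (\<Prod>r\<in>set rs. 1 / (om01_sheet r u - om01_sheet p u))"
proof -
  let ?z = "sheet u" and ?I = "set rs"
  let ?framed = "\<lambda>z. (coord_at (atlas S) z, z)"
  \<comment> \<open>J and \<open>cd r\<close> are the derivatives of \<zeta> with respect to c on
    the sheet of p and to the arbitrary chart on that of r; D is dx/d\<zeta>.\<close>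
  define J where "J = coord_deriv c (Z p) (?z p)"
  define cd where "cd r = coord_deriv (coord_at (atlas S) (?z r)) (Z r) (?z r)" for r
  define D where "D = deriv (fin_part \<circ> sphere_chart q) u"
  define G where "G = Wprime \<omega> g (map (\<lambda>r. (Z r, ?z r)) (p # rs)) ws"
  have "D \<noteq> 0" unfolding D_def by (rule sphere_chart_derivative(2)[OF u(2)])
  have zU: "?z r \<in> U r" "snd (Z r) (?z r) = u" if "r \<in> P" for r
    using sheet[OF u(1) that] .
  have IP: "r \<in> P" if "r \<in> ?I" for r using that rs by auto
  have J: "J \<noteq> 0" unfolding J_def by (rule coord_deriv_Z_nonzero[OF p zU(1)[OF p] c])
  have cd: "cd r \<noteq> 0" if "r \<in> P" for r
    unfolding cd_def by (rule coord_deriv_Z_nonzero[OF that zU(1)[OF that] framed])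
  have dxc: "dx S (c, ?z p) = D * J"
    using dx_eq[OF p zU(1)[OF p] _ c] zU(2)[OF p] u(2) by (simp add: D_def J_def)
  have dxr: "dx S (?framed (?z r)) = D * cd r" if "r \<in> P" for r
    using dx_eq[OF that zU(1)[OF that] _ framed] zU(2)[OF that] u(2) by (simp add: D_def cd_def)
  have y: "yfun S (?z r) = om01_sheet r u / D" if "r \<in> P" for r
    using yfun_eq[OF that zU(1)[OF that]] zU(2)[OF that] u(2)
    by (simp add: D_def om01_sheet_def sheet_def)
  have inj: "inj_on ?z ?I"
    using inj_on_sheet[OF u(1)] by (rule inj_on_subset) (use rs in auto)
  have "(\<Prod>z'\<in>?z ` ?I. (yfun S z' - yfun S (?z p)) * dx S (c, ?z p))
      = (\<Prod>r\<in>?I. (yfun S (?z r) - yfun S (?z p)) * dx S (c, ?z p))"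
    using inj by (simp add: prod.reindex)
  also have "\<dots> = (\<Prod>r\<in>?I. (om01_sheet r u - om01_sheet p u) * J)"
    using \<open>D \<noteq> 0\<close> by (intro prod.cong refl) (simp add: y IP p dxc field_simps)
  finally have K: "Kernel S \<alpha> w0 (c, ?z p) (?z ` ?I)
      = - \<alpha> w0 (?z p) / ((\<Prod>r\<in>?I. om01_sheet r u - om01_sheet p u) * (\<Prod>r\<in>?I. J))"
    by (simp add: Kernel_def prod.distrib)
  define zs where "zs = (SOME zs. distinct zs \<and> set zs = ?z ` ?I)"
  have "distinct zs \<and> set zs = ?z ` ?I"
    unfolding zs_def by (rule someI_ex) (use finite_distinct_list[of "?z ` ?I"] in blast)
  then have mset: "mset zs = mset (map ?z rs)"
    using rs(1) inj by (intro set_eq_iff_mset_eq_distinct[THEN iffD1]) (auto simp: distinct_map)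
  \<comment> \<open>The framings of z and of the other points become one function of the sheet, so
    that one application of \<open>Wprime_change_coords\<close> treats them all; this uses that p is
    not in \<open>rs\<close>.\<close>
  let ?c = "\<lambda>r. if r = p then c else coord_at (atlas S) (?z r)"
  have list: "map (\<lambda>r. (?c r, ?z r)) (p # rs) = (c, ?z p) # map ?framed (map ?z rs)"
    using rs(2) by auto
  have fp: "(?c r, ?z r) \<in> fpoints (atlas S)" if "r \<in> set (p # rs)" for r
    using c framed by simp
  have sub: "set ((c, ?z p) # map ?framed zs) \<subseteq> fpoints (atlas S)"
    using c framed by auto
  have sym: "symmetric_ndiff (atlas S) n (\<omega> h n)" and mer: "mero_ndiff (atlas S) n (\<omega> h n)" if "n \<ge> 1" for h n
    using \<omega> that unfolding correlators_def by blast+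
  have "mset ((c, ?z p) # map ?framed zs) = mset ((c, ?z p) # map ?framed (map ?z rs))"
    using mset by (simp only: mset.simps mset_map)
  from Wprime_cong_mset[where A = "atlas S" and \<omega> = \<omega> and ws = ws and g = g, OF this sym sub ws]
  have "Wprime \<omega> g ((c, ?z p) # map ?framed zs) ws = Wprime \<omega> g (map (\<lambda>r. (?c r, ?z r)) (p # rs)) ws"
    by (simp only: list)
  also have "\<dots> = G * prod_list (map (\<lambda>r. coord_deriv (?c r) (Z r) (?z r)) (p # rs))"
    unfolding G_def
  proof (rule Wprime_change_coords[where A = "atlas S", OF atlas mer fp _ ws])
    show "(Z r, ?z r) \<in> fpoints (atlas S)" if "r \<in> set (p # rs)" for r
      using that framed_Z zU(1) p IP by auto
  qed
  also have "prod_list (map (\<lambda>r. coord_deriv (?c r) (Z r) (?z r)) (p # rs)) = J * prod_list (map cd rs)"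
    using rs(2) by (auto simp: J_def cd_def intro!: arg_cong[where f = prod_list] map_cong)
  also have "prod_list (map cd rs) = (\<Prod>r\<in>?I. cd r)"
    using rs(1) by (simp add: prod.distinct_set_conv_list)
  finally have W: "Wprime_pullback S \<omega> g (c, ?z p) (?z ` ?I) ws
     = G * (J * (\<Prod>r\<in>?I. cd r)) * (\<Prod>z'\<in>?z ` ?I. dx S (c, ?z p) / dx S (?framed z'))"
    by (simp add: Wprime_pullback_def Let_def zs_def)
  also have "(\<Prod>z'\<in>?z ` ?I. dx S (c, ?z p) / dx S (?framed z')) = (\<Prod>r\<in>?I. J / cd r)"
    using inj \<open>D \<noteq> 0\<close> by (simp add: prod.reindex dxc dxr IP)
  also have "\<dots> = (\<Prod>r\<in>?I. J) / (\<Prod>r\<in>?I. cd r)"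
    by (rule prod_dividef)
  finally have W: "Wprime_pullback S \<omega> g (c, ?z p) (?z ` ?I) ws
     = G * (J * (\<Prod>r\<in>?I. cd r)) * ((\<Prod>r\<in>?I. J) / (\<Prod>r\<in>?I. cd r))" .
  have "(\<Prod>r\<in>?I. J) \<noteq> 0" "(\<Prod>r\<in>?I. cd r) \<noteq> 0"
    using J cd IP by auto
  then have "- \<alpha> w0 (?z p) / ((\<Prod>r\<in>?I. om01_sheet r u - om01_sheet p u) * (\<Prod>r\<in>?I. J))
       * (G * (J * (\<Prod>r\<in>?I. cd r)) * ((\<Prod>r\<in>?I. J) / (\<Prod>r\<in>?I. cd r)))
     = - \<alpha> w0 (?z p) * G * J * (1 / (\<Prod>r\<in>?I. om01_sheet r u - om01_sheet p u))"
    by (simp add: field_simps)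
  also have "1 / (\<Prod>r\<in>?I. om01_sheet r u - om01_sheet p u)
      = (\<Prod>r\<in>?I. 1 / (om01_sheet r u - om01_sheet p u))"
    by (simp add: prod_dividef)
  finally show ?thesis
    unfolding K W by (simp only: J_def G_def sheet_def)
qed

text \<open>Near p the sum has no terms: the only subset of \<open>fprime S U {p} z\<close> is empty
  and is excluded by \<open>card Y \<ge> 1\<close>.\<close>

lemma local_residue_zero: "recursion_residue S \<omega> \<alpha> (fprime S U {p}) g w0 ws p = 0" if p: "p \<in> P"
proof -
  let ?c = "coord_at (atlas S) p"
  note c = coord_at_in[OF atlas, of p]
  let ?f = "\<lambda>t. \<Sum>Y | Y \<subseteq> fprime S U {p} (coord_inv ?c t) \<and> card Y \<ge> 1.
     Kernel S \<alpha> w0 (?c, coord_inv ?c t) Y * Wprime_pullback S \<omega> g (?c, coord_inv ?c t) Y ws"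
  have "fprime S U {p} z = {}" if z: "z \<in> U p" for z
  proof -
    have "z' = z" if "z' \<in> U p" "xmap S z' = xmap S z" for z'
    proof -
      have "sphere_chart q (snd (Z p) z') = sphere_chart q (snd (Z p) z)"
        using that(2) unfolding xmap_U[OF p that(1)] xmap_U[OF p z] .
      then have "snd (Z p) z' = snd (Z p) z"
        by (rule injD[OF inj_sphere_chart])
      then show ?thesis
        using Z_inv[OF p that(1)] Z_inv[OF p z] by metis
    qed
    then show ?thesis by (auto simp: fprime_def)
  qed
  moreover have "\<forall>\<^sub>F t in nhds (snd ?c p). coord_inv ?c t \<in> U p"
    using eventually_coord_inv[OF atlas c(1) open_U[OF p] c(2) in_U[OF p]] by eventually_elim simp
  ultimately have "\<forall>\<^sub>F t in nhds (snd ?c p). ?f t = 0"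
    by (auto elim!: eventually_mono intro!: sum.neutral)
  then have "residue ?f (snd ?c p) = residue (\<lambda>_. 0) (snd ?c p)"
    by (intro residue_cong) (auto simp: eventually_at_filter elim: eventually_mono)
  also have "\<dots> = 0"
    by (rule residue_holo[of UNIV]) auto
  finally show ?thesis
    by (simp add: recursion_residue_def form_residue_def Let_def)
qed

end

lemma primitive_analytic:
  assumes "primitive_regular_at S \<alpha> f z" "f \<in> fpoints (atlas S)" "(d, z) \<in> fpoints (atlas S)"
  shows "(\<lambda>t. \<alpha> f (coord_inv d t)) analytic_on {snd d z}"
proof -
  let ?w = "snd (fst f) (snd f)"
  have "holo_near (primitive_expr \<alpha> (fst f) d) [?w, snd d z]"
    using assms(1,3) unfolding primitive_regular_at_def by blast
  then have "(\<lambda>t. primitive_expr \<alpha> (fst f) d [?w, t]) analytic_on {snd d z}"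
    by (rule analytic_along_affine_curve[where \<gamma> = "\<lambda>t. [?w, t]" and n = 2
          and k = "\<lambda>i. of_nat i" and b = "\<lambda>i. if i = 0 then ?w else 0"])
      (auto simp: less_2_cases_iff)
  moreover have "primitive_expr \<alpha> (fst f) d [?w, t] = \<alpha> f (coord_inv d t)" for t
    using assms(2) local_coordsD(3)[of "fst f" "atlas S" "snd f"]
    by (simp add: primitive_expr_def fpoints_def case_prod_beta)
  ultimately show ?thesis by simp
qed

lemma sum_nonempty_subsets_image:
  assumes "inj_on f Q"
  shows "(\<Sum>Y | Y \<subseteq> f ` Q \<and> card Y \<ge> 1. T Y) = (\<Sum>I | I \<subseteq> Q \<and> card I \<ge> 1. T (f ` I))"
proof (rule sum.reindex_bij_witness[of _ "\<lambda>I. f ` I" "\<lambda>Y. Q \<inter> f -` Y"], goal_cases)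
  case (2 Y)
  have "f ` (Q \<inter> f -` Y) = Y" using 2 by auto
  then show ?case
    using 2 card_image[OF inj_on_subset[OF assms], of "Q \<inter> f -` Y"] by auto
next
  case (3 I)
  then show ?case using assms by (auto simp: inj_on_def)
next
  case (4 I)
  then show ?case using card_image[OF inj_on_subset[OF assms], of I] by auto
next
  case (5 Y)
  have "f ` (Q \<inter> f -` Y) = Y" using 5 by auto
  then show ?case by simp
qed auto

section \<open>The residues of the global sum\<close>

context unramified_fibre
begin

text \<open>The residue is taken in the chart c, while \<open>summand_eq\<close> speaks of u =
  \<phi> t, with \<phi> the transition from c to \<open>Z p\<close>. Substituting \<phi> and
  replacing the inverse differences by their holomorphic extensions \<open>E r\<close> yields a
  function h that is holomorphic at b and equals the integrand off b.\<close>

lemma global_residue_zero: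
  assumes \<omega>: "correlators S \<omega>" and p: "p \<in> P" and Ram: "P \<inter> Ram S = {}"
    and sbar: "\<And>r. r \<in> P \<Longrightarrow> r \<noteq> p \<Longrightarrow> \<not> (sbar S p \<ge> 2 \<and> sbar S r \<ge> 2)"
    and tau: "\<And>r. r \<in> P \<Longrightarrow> r \<noteq> p \<Longrightarrow> sbar S p = sbar S r \<Longrightarrow> tau S p \<noteq> tau S r"
    and w0: "w0 \<in> fpoints (atlas S)" and \<alpha>: "primitive_regular_at S \<alpha> w0 p"
    and ws: "set ws \<subseteq> fpoints (atlas S)" "snd ` set ws \<inter> (P \<union> Ram S) = {}"
  shows "recursion_residue S \<omega> \<alpha> (fprime S U P) g w0 ws p = 0"
proof -
  define c where "c = coord_at (atlas S) p"
  have c: "c \<in> local_coords (atlas S)" "p \<in> fst c"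
    unfolding c_def by (rule coord_at_in[OF atlas])+
  define b where "b = snd c p"
  define \<phi> where "\<phi> = snd (Z p) \<circ> coord_inv c"
  have \<phi>: "\<phi> analytic_on {b}"
    unfolding \<phi>_def b_def using in_U[OF p] standard(2)[OF p]
    by (intro analytic_transition[OF atlas c(1) Z_local[OF p] c(2)]) simp
  have \<phi>b: "\<phi> b = 0"
    unfolding \<phi>_def b_def using local_coordsD(3)[OF c] Z_centred[OF p] by simp
  have chart: "\<forall>\<^sub>F t in at b. coord_inv c t \<in> U p \<inter> fst c \<and> snd c (coord_inv c t) = t"
    unfolding b_def using eventually_coord_inv[OF atlas c(1) open_U[OF p] c(2) in_U[OF p]]
    by (auto simp: eventually_at_filter elim: eventually_mono)
  have nz: "\<forall>\<^sub>F t in at b. \<phi> t \<noteq> 0"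
  proof -
    have "\<forall>\<^sub>F t in at b. t \<noteq> b" by (simp add: eventually_at_filter)
    with chart show ?thesis
    proof eventually_elim
      case (elim t)
      then have "coord_inv c t \<noteq> p" by (auto simp: b_def)
      moreover have "coord_inv c t = p" if "\<phi> t = 0"
        using that elim Z_inv[OF p, of "coord_inv c t"] Z_inv[OF p in_U[OF p]] Z_centred[OF p]
        by (simp add: \<phi>_def)
      ultimately show ?case by blast
    qed
  qed
  have "(\<phi> \<longlongrightarrow> 0) (at b)"
    using analytic_at_imp_isCont[OF \<phi>] \<phi>b by (simp add: isCont_def)
  \<comment> \<open>The second limit carries over the equation for \<open>E r\<close>, which is
    known only for u near but different from 0; it needs that \<phi> has no zero near b other than
    b.\<close>
  then have lim: "filterlim \<phi> (nhds 0) (at b)" "filterlim \<phi> (at 0) (at b)"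
    using nz by (auto intro: filterlim_atI)
  have even: "\<forall>\<^sub>F t in at b. evenly_covered (\<phi> t)"
    by (rule eventually_compose_filterlim[OF eventually_evenly_covered lim(1)])
  define E where "E r = (SOME e. e analytic_on {0} \<and>
      (\<forall>\<^sub>F u in at 0. e u = 1 / (om01_sheet r u - om01_sheet p u)))" for r
  have E: "E r analytic_on {0}" "\<forall>\<^sub>F u in at 0. E r u = 1 / (om01_sheet r u - om01_sheet p u)"
    if r: "r \<in> P" "r \<noteq> p" for r
  proof -
    have "\<exists>e. e analytic_on {0} \<and> (\<forall>\<^sub>F u in at 0. e u = 1 / (om01_sheet r u - om01_sheet p u))"
      unfolding om01_sheet_def
      by (rule inverse_diff_om01_analytic[OF spectral_curve standard(1)[OF p] unramified[OF p]
          standard(1)[OF r(1)] unramified[OF r(1)] sbar[OF r] tau[OF r]])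
        (assumption | intro exI conjI)+
    from someI_ex[OF this] show "E r analytic_on {0}"
      "\<forall>\<^sub>F u in at 0. E r u = 1 / (om01_sheet r u - om01_sheet p u)"
      unfolding E_def by blast+
  qed
  have "\<forall>\<^sub>F u in at 0. \<forall>r\<in>P - {p}. E r u = 1 / (om01_sheet r u - om01_sheet p u)"
    using finite_fibre E(2) by (intro eventually_ball_finite) auto
  then have Eev: "\<forall>\<^sub>F t in at b. \<forall>r\<in>P - {p}. E r (\<phi> t) = 1 / (om01_sheet r (\<phi> t) - om01_sheet p (\<phi> t))"
    by (rule eventually_compose_filterlim[OF _ lim(2)])
  define rs where "rs I = (SOME l. distinct l \<and> set l = I)" for I :: "'a set"
  have rs: "distinct (rs I)" "set (rs I) = I" if "I \<subseteq> P - {p}" for I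
  proof -
    have "\<exists>l. distinct l \<and> set l = I"
      using finite_distinct_list[of I] finite_subset[OF that] finite_fibre by blast
    from someI_ex[OF this] show "distinct (rs I)" "set (rs I) = I"
      unfolding rs_def by blast+
  qed
  define G where "G I = (\<lambda>u. Wprime \<omega> g (map (\<lambda>r. (Z r, coord_inv (Z r) u)) (p # rs I)) ws)" for I
  have G: "G I analytic_on {0}" if I: "I \<subseteq> P - {p}" for I
    unfolding G_def
  proof (rule Wprime_analytic[OF refl \<omega> spectral_curve])
    show "Z r \<in> local_coords (atlas S) \<and> r \<in> fst (Z r) \<and> snd (Z r) r = 0" if "r \<in> set (p # rs I)" for r
    proof -
      have "r \<in> P" using that rs[OF I] I p by auto
      then show ?thesis using Z_local in_U standard(2) Z_centred by simp
    qed
    show "distinct (p # rs I)" using rs[OF I] I by auto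
    have "set (p # rs I) \<subseteq> P" using rs[OF I] I p by auto
    then show "set (p # rs I) \<inter> Ram S = {}" "snd ` set ws \<inter> (set (p # rs I) \<union> Ram S) = {}"
      using Ram ws(2) by blast+
  qed (rule ws(1))
  define h where "h t = (\<Sum>I | I \<subseteq> P - {p} \<and> card I \<ge> 1.
      - \<alpha> w0 (coord_inv c t) * G I (\<phi> t) * deriv \<phi> t * (\<Prod>r\<in>I. E r (\<phi> t)))" for t
  have comp: "(\<lambda>t. k (\<phi> t)) analytic_on {b}" if "k analytic_on {0}" for k
    using analytic_on_compose[OF \<phi>, of k] that \<phi>b by (simp add: o_def)
  have "h analytic_on {b}"
    unfolding h_def
  proof (intro analytic_on_sum analytic_on_mult analytic_on_neg analytic_on_prod)
    show "(\<lambda>t. \<alpha> w0 (coord_inv c t)) analytic_on {b}"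
      unfolding b_def using c by (intro primitive_analytic[OF \<alpha> w0]) (simp add: fpoints_def)
    show "(\<lambda>t. deriv \<phi> t) analytic_on {b}"
      using analytic_deriv[OF \<phi>] .
  qed (auto intro!: comp G E)
  then obtain s where s: "open s" "b \<in> s" "h holomorphic_on s"
    unfolding analytic_at by blast
  let ?f = "\<lambda>t. \<Sum>Y | Y \<subseteq> fprime S U P (coord_inv c t) \<and> card Y \<ge> 1.
     Kernel S \<alpha> w0 (c, coord_inv c t) Y * Wprime_pullback S \<omega> g (c, coord_inv c t) Y ws"
  have "\<forall>\<^sub>F t in at b. ?f t = h t"
    using chart nz even Eev
  proof eventually_elim
    case (elim t)
    let ?u = "\<phi> t"
    have z: "sheet ?u p = coord_inv c t"
      using elim Z_inv[OF p] by (simp add: sheet_def \<phi>_def)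
    have cz: "(c, sheet ?u p) \<in> fpoints (atlas S)"
      using elim c(1) by (simp add: fpoints_def z)
    \<comment> \<open>The surviving Jacobian is the derivative of the transition map, hence itself
      holomorphic in t.\<close>
    have J: "coord_deriv c (Z p) (sheet ?u p) = deriv \<phi> t"
      using elim(1) unfolding z by (simp add: coord_deriv_def \<phi>_def)
    have "?f t = (\<Sum>Y | Y \<subseteq> sheet ?u ` (P - {p}) \<and> card Y \<ge> 1.
       Kernel S \<alpha> w0 (c, sheet ?u p) Y * Wprime_pullback S \<omega> g (c, sheet ?u p) Y ws)"
      unfolding z[symmetric] fprime_sheet[OF elim(3) p subset_refl] ..
    also have "\<dots> = (\<Sum>I | I \<subseteq> P - {p} \<and> card I \<ge> 1.
       Kernel S \<alpha> w0 (c, sheet ?u p) (sheet ?u ` I) * Wprime_pullback S \<omega> g (c, sheet ?u p) (sheet ?u ` I) ws)"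
      using inj_on_sheet[OF elim(3)] by (intro sum_nonempty_subsets_image) (auto elim: inj_on_subset)
    also have "\<dots> = h t"
      unfolding h_def
    proof (intro sum.cong refl)
      fix I assume "I \<in> {I. I \<subseteq> P - {p} \<and> card I \<ge> 1}"
      then have I: "I \<subseteq> P - {p}" by simp
      have "(\<Prod>r\<in>I. E r ?u) = (\<Prod>r\<in>I. 1 / (om01_sheet r ?u - om01_sheet p ?u))"
        using elim(4) I by (intro prod.cong) auto
      moreover have "set (rs I) \<subseteq> P - {p}" using rs(2)[OF I] I by simp
      note summand_eq[OF \<omega> elim(3,2) p cz rs(1)[OF I] this ws(1), where \<alpha> = \<alpha> and ?w0.0 = w0 and g = g,
          unfolded rs(2)[OF I]]
      ultimately show "Kernel S \<alpha> w0 (c, sheet ?u p) (sheet ?u ` I)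
          * Wprime_pullback S \<omega> g (c, sheet ?u p) (sheet ?u ` I) ws
        = - \<alpha> w0 (coord_inv c t) * G I ?u * deriv \<phi> t * (\<Prod>r\<in>I. E r ?u)"
        by (simp only: J[unfolded z] G_def z)
    qed
    finally show ?case .
  qed
  then have "residue ?f b = residue h b"
    by (rule residue_cong) simp
  also have "\<dots> = 0"
    by (rule residue_holo[OF s])
  finally show ?thesis
    by (simp add: recursion_residue_def form_residue_def Let_def c_def b_def)
qed

end

theorem lemma3p15:
  fixes S :: "'a::t2_space spectral_data"
    and \<omega> :: "nat \<Rightarrow> nat \<Rightarrow> 'a ndiff"
    and q :: sphere
  assumes "spectral_curve S"
    and "locally_admissible S"
    and "correlators S \<omega>"
    and "topological_recursion S \<omega>"
    and "q \<in> range (xmap S)"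
    and "q \<notin> xmap S ` Ram S"
    and "finite (xmap S -` {q})"
    and "\<forall>p\<in>xmap S -` {q}. \<forall>p'\<in>xmap S -` {q}. sbar S p \<ge> 2 \<and> sbar S p' \<ge> 2 \<longrightarrow> p = p'"
    and "\<forall>p\<in>xmap S -` {q}. \<forall>p'\<in>xmap S -` {q}.
           p \<noteq> p' \<and> sbar S p = sbar S p' \<longrightarrow> tau S p \<noteq> tau S p'"
  shows "globalisable_over S \<omega> q (xmap S -` {q})"
  unfolding globalisable_over_def
proof (intro allI impI, elim conjE)
  fix V U \<alpha> g n w0 ws
  assume nbhds: "fibre_nbhds S q V U"
    and w: "set (w0 # ws) \<subseteq> fpoints (atlas S)" "snd ` set ws \<inter> (xmap S -` {q} \<union> Ram S) = {}"
    and \<alpha>: "\<forall>p\<in>xmap S -` {q}. primitive_regular_at S (\<alpha> p) w0 p"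
  let ?P = "xmap S -` {q}"
  have "\<exists>\<zeta>. standard_coord S p (U p, \<zeta>)" if "p \<in> ?P" for p
    using nbhds that unfolding fibre_nbhds_def by blast
  then obtain \<zeta> where \<zeta>: "\<And>p. p \<in> ?P \<Longrightarrow> standard_coord S p (U p, \<zeta> p)"
    by metis
  have Ram: "?P \<inter> Ram S = {}"
    using assms(6) by auto
  have unramified: "ram_order S p = 1" if p: "p \<in> ?P" for p
  proof -
    have "ram_order S p < 2"
      using Ram p by (auto simp: Ram_def)
    \<comment> \<open>\<open>ram_order\<close> is a truncation to the naturals, so 0 has to be
      excluded. The exponent 0 in the equation of a standard coordinate, evaluated at p where
      \<zeta> = 0, would give 0 ^ 0 = 1 and contradict the value of x at p.\<close>
    moreover have "ram_order S p \<noteq> 0"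
    proof
      assume "ram_order S p = 0"
      then have "xmap S p = (case xmap S p of Fin a \<Rightarrow> Fin (a + 1) | Infty \<Rightarrow> Fin 1)"
        using \<zeta>[OF p] by (auto simp: standard_coord_def split: sphere.splits)
      then show False by (auto split: sphere.splits)
    qed
    ultimately show ?thesis by linarith
  qed
  interpret unramified_fibre S q ?P V U "\<lambda>p. (U p, \<zeta> p)"
    by unfold_locales (use assms(1,7) nbhds unramified \<zeta> in auto)
  have "recursion_residue S \<omega> (\<alpha> p) (fprime S U {p}) g w0 ws p
      = recursion_residue S \<omega> (\<alpha> p) (fprime S U ?P) g w0 ws p" if p: "p \<in> ?P" for p
  proof -
    have "recursion_residue S \<omega> (\<alpha> p) (fprime S U ?P) g w0 ws p = 0"
      using assms(3) p Ram
    proof (rule global_residue_zero)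
      show "\<not> (sbar S p \<ge> 2 \<and> sbar S r \<ge> 2)" if "r \<in> ?P" "r \<noteq> p" for r
        using assms(8) p that by blast
      show "tau S p \<noteq> tau S r" if "r \<in> ?P" "r \<noteq> p" "sbar S p = sbar S r" for r
        using assms(9)[rule_format, OF p that(1)] that(2,3) by auto
    qed (use w \<alpha> p in auto)
    then show ?thesis
      using local_residue_zero[OF p] by simp
  qed
  then show "(\<Sum>p\<in>?P. recursion_residue S \<omega> (\<alpha> p) (fprime S U {p}) g w0 ws p)
      = (\<Sum>p\<in>?P. recursion_residue S \<omega> (\<alpha> p) (fprime S U ?P) g w0 ws p)"
    by (rule sum.cong[OF refl])
qed

end
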